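(* Let $F$ be a forest. Then $\mathcal{D}(F;P_3)$ is contractible or is homotopy equivalent to a wedge of spheres of dimension at most $2\,\mathrm{ind}_3(F)-1$.
   Context: Graphs are finite and undirected. $P_3$ denotes the path graph on $3$ vertices. For a graph $G=(V,E)$ and $S\subseteq V$, $G[S]$ is the subgraph induced by $S$; a graph is $P_3$-free if it contains no (not necessarily induced) subgraph isomorphic to $P_3$. The devoid complex $\mathcal{D}(G;P_3)$ is the simplicial complex on $V$ whose faces are those $S\subseteq V$ such that $G[S]$ is $P_3$-free. An induced $P_3$-matching in $G$ is a set of pairwise vertex-disjoint copies of $P_3$ in $G$ such that no additional edge of $G$ is spanned by the vertices covered by these copies; $\mathrm{ind}_3(G)$ is the maximum size of an induced $P_3$-matching of $G$. A forest is a cycle-free graph. The complex $\{\emptyset\}$ is regarded as $S^{-1}$. *)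

theory Defs
  imports "HOL-Analysis.Analysis"
begin

section \<open>Finite simple graphs\<close>

type_synonym 'v graph = "'v set \<times> 'v set set"

abbreviation verts :: "'v graph \<Rightarrow> 'v set" where "verts G \<equiv> fst G"
abbreviation edges :: "'v graph \<Rightarrow> 'v set set" where "edges G \<equiv> snd G"

definition fin_graph :: "'v graph \<Rightarrow> bool" where
  "fin_graph G \<longleftrightarrow> finite (verts G) \<and> (\<forall>e\<in>edges G. e \<subseteq> verts G \<and> card e = 2)"

definition subgraph :: "'v graph \<Rightarrow> 'v graph \<Rightarrow> bool" where
  "subgraph H G \<longleftrightarrow> fin_graph H \<and> verts H \<subseteq> verts G \<and> edges H \<subseteq> edges G"

definition induced_subgraph :: "'v graph \<Rightarrow> 'v set \<Rightarrow> 'v graph" where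
  "induced_subgraph G S = (verts G \<inter> S, {e \<in> edges G. e \<subseteq> S})"

definition graph_iso :: "'v graph \<Rightarrow> 'w graph \<Rightarrow> bool" where
  "graph_iso G H \<longleftrightarrow> (\<exists>f. bij_betw f (verts G) (verts H) \<and> edges H = (\<lambda>e. f ` e) ` edges G)"

definition path_graph :: "nat \<Rightarrow> nat graph" where
  "path_graph n = ({..<n}, {{i, Suc i} |i. Suc i < n})"

definition is_cycle :: "'v graph \<Rightarrow> 'v list \<Rightarrow> bool" where
  "is_cycle G c \<longleftrightarrow> 3 \<le> length c \<and> distinct c \<and> set c \<subseteq> verts G \<and>
     (\<forall>i<length c. {c ! i, c ! (Suc i mod length c)} \<in> edges G)"

definition forest :: "'v graph \<Rightarrow> bool" where
  "forest G \<longleftrightarrow> fin_graph G \<and> \<not> (\<exists>c. is_cycle G c)"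

text \<open>A copy of \<open>H\<close> in \<open>G\<close> is a not necessarily induced subgraph of \<open>G\<close> isomorphic to \<open>H\<close>.\<close>

definition copies :: "'w graph \<Rightarrow> 'v graph \<Rightarrow> 'v graph set" where
  "copies H G = {C. subgraph C G \<and> graph_iso C H}"

definition graph_free :: "'w graph \<Rightarrow> 'v graph \<Rightarrow> bool" where
  "graph_free H G \<longleftrightarrow> copies H G = {}"

definition induced_matching :: "'w graph \<Rightarrow> 'v graph \<Rightarrow> 'v graph set \<Rightarrow> bool" where
  "induced_matching H G M \<longleftrightarrow>
     M \<subseteq> copies H G \<and>
     (\<forall>C\<in>M. \<forall>D\<in>M. C \<noteq> D \<longrightarrow> verts C \<inter> verts D = {}) \<and>
     edges (induced_subgraph G (\<Union>C\<in>M. verts C)) = (\<Union>C\<in>M. edges C)"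

definition ind_number :: "'w graph \<Rightarrow> 'v graph \<Rightarrow> nat" where
  "ind_number H G = Max {card M |M. induced_matching H G M}"

abbreviation ind3 :: "'v graph \<Rightarrow> nat" where
  "ind3 G \<equiv> ind_number (path_graph 3) G"

lemma ind_number_Max_well_defined:
  assumes "fin_graph G"
  shows "finite {card M |M. induced_matching H G M}" "{card M |M. induced_matching H G M} \<noteq> {}"
proof -
  have "edges G \<subseteq> Pow (verts G)" using assms by (auto simp: fin_graph_def)
  then have fin: "finite (Pow (verts G) \<times> Pow (edges G))"
    using assms by (meson fin_graph_def finite_Pow_iff finite_SigmaI finite_subset)
  have "{M. induced_matching H G M} \<subseteq> Pow (Pow (verts G) \<times> Pow (edges G))"
    unfolding induced_matching_def copies_def subgraph_def by force
  then have "finite {M. induced_matching H G M}"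
    using fin finite_subset by blast
  moreover have "{card M |M. induced_matching H G M} = card ` {M. induced_matching H G M}"
    by auto
  ultimately show "finite {card M |M. induced_matching H G M}" by simp
  have "induced_matching H G {}"
    using assms by (auto simp: induced_matching_def induced_subgraph_def fin_graph_def)
  then show "{card M |M. induced_matching H G M} \<noteq> {}" by blast
qed


section \<open>The devoid complex and its geometric realization\<close>

text \<open>A simplicial complex is given by its set of faces (including the empty face).\<close>

definition devoid_complex :: "'v graph \<Rightarrow> 'w graph \<Rightarrow> 'v set set" where
  "devoid_complex G H = {S. S \<subseteq> verts G \<and> graph_free H (induced_subgraph G S)}"

text \<open>
  The geometric realization via barycentric coordinates, as a subspace of the product of copies
  of the real line indexed by the vertices (coordinates of non-vertices are \<open>undefined\<close>, as usual
  for \<open>extensional\<close>).  This is the usual topology for complexes with finitely many vertices, the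
  only ones considered here.  The complex \<open>{{}}\<close> has the empty realization.
\<close>

definition geometric_realization :: "'v set set \<Rightarrow> ('v \<Rightarrow> real) topology" where
  "geometric_realization K =
     subtopology (powertop_real (\<Union>K))
       {x. (\<forall>v\<in>\<Union>K. 0 \<le> x v) \<and> (\<Sum>v\<in>\<Union>K. x v) = 1 \<and> {v \<in> \<Union>K. x v \<noteq> 0} \<in> K}"


section \<open>Wedges of spheres\<close>

text \<open>
  The wedge of the pointed spaces \<open>(X i, p i)\<close>, \<open>i \<in> I\<close>, for nonempty \<open>I\<close>: the quotient of the
  disjoint union that collapses all base points to the single point \<open>None\<close>.
\<close>

definition wedge_map :: "('i \<Rightarrow> 'a) \<Rightarrow> 'i \<times> 'a \<Rightarrow> ('i \<times> 'a) option" where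
  "wedge_map p = (\<lambda>(i, x). if x = p i then None else Some (i, x))"

definition wedge_topology ::
    "('i \<Rightarrow> 'a topology) \<Rightarrow> ('i \<Rightarrow> 'a) \<Rightarrow> 'i set \<Rightarrow> ('i \<times> 'a) option topology" where
  "wedge_topology X p I =
     topology (\<lambda>U. U \<subseteq> wedge_map p ` topspace (sum_topology X I) \<and>
                    openin (sum_topology X I) {z \<in> topspace (sum_topology X I). wedge_map p z \<in> U})"

lemma openin_wedge_topology:
  "openin (wedge_topology X p I) U \<longleftrightarrow>
     U \<subseteq> wedge_map p ` topspace (sum_topology X I) \<and>
     openin (sum_topology X I) {z \<in> topspace (sum_topology X I). wedge_map p z \<in> U}"
proof -
  let ?S = "sum_topology X I" and ?q = "wedge_map p"
  have 1: "{z \<in> topspace ?S. ?q z \<in> U \<inter> V} =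
      {z \<in> topspace ?S. ?q z \<in> U} \<inter> {z \<in> topspace ?S. ?q z \<in> V}" for U V
    by auto
  have 2: "{z \<in> topspace ?S. ?q z \<in> \<Union>\<K>} = (\<Union>U\<in>\<K>. {z \<in> topspace ?S. ?q z \<in> U})" for \<K>
    by auto
  have "istopology (\<lambda>U. U \<subseteq> ?q ` topspace ?S \<and> openin ?S {z \<in> topspace ?S. ?q z \<in> U})"
    unfolding istopology_def 1 2 by (auto intro!: openin_Int openin_Union simp del: Union_iff)
  then show ?thesis
    by (simp add: wedge_topology_def)
qed

lemma quotient_map_wedge_topology:
  "quotient_map (sum_topology X I) (wedge_topology X p I) (wedge_map p)"
proof -
  let ?S = "sum_topology X I"
  have "topspace (wedge_topology X p I) = wedge_map p ` topspace ?S"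
  proof
    show "topspace (wedge_topology X p I) \<subseteq> wedge_map p ` topspace ?S"
      using openin_topspace openin_wedge_topology by metis
    have "{z \<in> topspace ?S. wedge_map p z \<in> wedge_map p ` topspace ?S} = topspace ?S" by auto
    then have "openin (wedge_topology X p I) (wedge_map p ` topspace ?S)"
      by (simp add: openin_wedge_topology del: topspace_sum_topology)
    then show "wedge_map p ` topspace ?S \<subseteq> topspace (wedge_topology X p I)"
      by (rule openin_subset)
  qed
  then show ?thesis
    by (simp add: quotient_map_def openin_wedge_topology del: topspace_sum_topology)
qed

definition nsphere_base :: "nat \<Rightarrow> real" where
  "nsphere_base = (\<lambda>i. if i = 0 then 1 else 0)"

lemma nsphere_base_in_nsphere: "nsphere_base \<in> topspace (nsphere n)"
proof -
  have "(\<Sum>i\<le>n. (nsphere_base i)\<^sup>2) = (\<Sum>i\<le>n. if i = 0 then 1 else 0)"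
    by (rule sum.cong) (auto simp: nsphere_base_def)
  then show ?thesis
    by (simp add: nsphere nsphere_base_def)
qed

text \<open>
  The \<open>(-1)\<close>-sphere is the empty space; having no base point, it occurs only as a wedge with
  itself as the single summand.  In the second disjunct the dimensions of the \<open>k \<ge> 1\<close> summands
  may differ.
\<close>

definition homotopy_wedge_of_spheres :: "'a topology \<Rightarrow> int \<Rightarrow> bool" where
  "homotopy_wedge_of_spheres X m \<longleftrightarrow>
     (-1 \<le> m \<and> X homotopy_equivalent_space (trivial_topology :: (nat \<Rightarrow> real) topology)) \<or>
     (\<exists>(k::nat) (d :: nat \<Rightarrow> nat). 0 < k \<and> (\<forall>i<k. int (d i) \<le> m) \<and>
        X homotopy_equivalent_space
          wedge_topology (\<lambda>i. nsphere (d i)) (\<lambda>_. nsphere_base) {..<k})"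

end

theory Submission
  imports Defs
begin

text \<open>The proof builds the complex out of a contractible piece and finitely many simplices glued along
  their boundaries.  Call a complex \<^emph>\<open>collapsible\<close> if it arises from the void
  complex by elementary expansions.  For a forest \<open>F\<close> there is a collapsible subcomplex \<open>A\<close> of
  \<open>K = \<D>(F; P\<^sub>3)\<close> such that every face outside \<open>A\<close> is a facet of \<open>K\<close> with \<open>2m\<close> vertices, where
  \<open>m\<close> is the size of some induced \<open>P\<^sub>3\<close>-matching (\<open>collapsible_plus_critical_facets\<close>).  If \<open>A\<close> is void
  then \<open>K\<close> is the \<open>(-1)\<close>-sphere; if there is no critical facet then \<open>K\<close> is contractible; otherwise
  collapsing the contractible \<open>|A|\<close> to a point turns every critical facet into a sphere of dimension
  \<open>2m - 1\<close> and does not change the homotopy type (\<open>realization_homotopy_equivalent_wedge\<close>).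

  The combinatorial step is an induction on vertex sets \<open>U\<close> which uses only that every nonempty set
  of vertices has a member with at most one neighbour in it.  Take such a vertex \<open>a\<close> of \<open>U\<close>.  If it is
  isolated, the complex is a cone.  Otherwise let \<open>v\<close> be its neighbour.  The faces that
  avoid \<open>v\<close>, together with those that contain \<open>v\<close> but no neighbour of \<open>v\<close> other than \<open>a\<close>, form a cone
  with apex \<open>a\<close>.  Each remaining face contains \<open>v\<close> and exactly one further neighbour \<open>u\<close>, and the
  rest of it is a face of the complex on \<open>U\<close> without the closed neighbourhoods of \<open>v\<close> and \<open>u\<close>.  So
  joining the edge \<open>{v, u}\<close> to the collapsible piece and the critical facets of these smaller
  complexes gives those of \<open>U\<close>.  A critical facet gains the two vertices \<open>v, u\<close> while the matching
  gains the path \<open>a v u\<close>, which is separated from everything that was left.\<close>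

section \<open>Collapsible complexes\<close>

text \<open>The start is the void complex, which lacks even the empty face: the first expansion adds the empty
  face together with a vertex.  This makes cones and joins uniform, since the empty face is
  matched like any other one.  It also makes the complex consisting of the empty face alone an
  instance of ``collapsible plus one critical facet''; the critical facets constructed below all grow
  out of that empty face by joining edges.\<close>

inductive collapsible :: "'v set set \<Rightarrow> bool" where
  void: "collapsible {}"
| expand: "collapsible (insert t (insert (insert x t) X))"
  if "collapsible X" "finite t" "x \<notin> t" "t \<notin> X"
     "\<And>r. r \<subset> insert x t \<Longrightarrow> r \<noteq> t \<Longrightarrow> r \<in> X"

lemma collapsible_downward_closed: "collapsible X \<Longrightarrow> s \<in> X \<Longrightarrow> r \<subseteq> s \<Longrightarrow> r \<in> X"
  by (induction arbitrary: s r rule: collapsible.induct) blast+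

text \<open>If adding or removing the vertex \<open>x\<close> pairs up the faces of \<open>Y\<close> outside \<open>X\<close>, then the pairs can be
  removed one at a time: a largest such face \<open>s\<close> contains \<open>x\<close>, and \<open>s - {x}\<close> is then a free face of it.
  With \<open>X\<close> void this says that cones are collapsible.\<close>

lemma collapsible_toggle:
  assumes "collapsible X" "X \<subseteq> Y" "finite Y" "\<And>s. s \<in> Y \<Longrightarrow> finite s"
    and down: "\<And>s r. s \<in> Y \<Longrightarrow> r \<subseteq> s \<Longrightarrow> r \<in> Y"
    and toggle: "\<And>s. s \<in> Y - X \<Longrightarrow> insert x s \<in> Y \<and> s - {x} \<notin> X"
  shows "collapsible Y"
  using assms(2-)
proof (induction "card (Y - X)" arbitrary: Y rule: less_induct)
  case less
  show ?case
  proof (cases "Y - X = {}")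
    case True
    with less.prems(1) \<open>collapsible X\<close> show ?thesis
      by (metis Diff_eq_empty_iff subset_antisym)
  next
    case False
    have "finite (Y - X)" using less.prems(2) by blast
    then have "Max (card ` (Y - X)) \<in> card ` (Y - X)" using False by (intro Max_in) auto
    then obtain s where s: "s \<in> Y - X" and "card s = Max (card ` (Y - X))" by auto
    then have smax: "\<And>t. t \<in> Y - X \<Longrightarrow> card t \<le> card s"
      using \<open>finite (Y - X)\<close> by simp
    have fs: "finite s" using s less.prems(3) by blast
    have xs: "x \<in> s"
    proof (rule ccontr)
      assume "x \<notin> s"
      have "insert x s \<in> Y - X"
        using s less.prems(5) collapsible_downward_closed[OF assms(1)] by blast
      from smax[OF this] show False using fs \<open>x \<notin> s\<close> by simp
    qed
    define t where "t = s - {x}"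
    have st: "s = insert x t" and xt: "x \<notin> t" using xs by (auto simp: t_def)
    have tX: "t \<in> Y - X" using s less.prems(4,5)[of s] by (auto simp: t_def)
    have top: "p = s" if p: "p \<in> Y - X" "t \<subset> p" "p \<noteq> t" for p
    proof -
      have "insert x p \<in> Y - X"
        using p less.prems(5) collapsible_downward_closed[OF assms(1)] by blast
      then have c: "card (insert x p) \<le> card s"
        using smax by blast
      have "finite (insert x p)" "s \<subseteq> insert x p" using p less.prems(3) st by blast+
      then have "insert x p = s" using card_seteq c by metis
      then have "p \<subseteq> insert x t" using st by blast
      then show ?thesis using p(2) xt unfolding st by blast
    qed
    let ?Z = "Y - {t, s}"
    have "collapsible ?Z"
    proof (rule less.hyps)
      show "card (?Z - X) < card (Y - X)"
        using s \<open>finite (Y - X)\<close> by (intro psubset_card_mono) auto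
      show "X \<subseteq> ?Z" using less.prems(1) s tX by blast
      show "finite ?Z" using less.prems(2) by blast
      show "finite q" if "q \<in> ?Z" for q using that less.prems(3) by blast
      show "r \<in> ?Z" if "q \<in> ?Z" "r \<subseteq> q" for q r
      proof -
        have "r \<in> Y" using that less.prems(4) by blast
        moreover have "r \<noteq> t \<and> r \<noteq> s"
        proof (rule ccontr)
          assume "\<not> (r \<noteq> t \<and> r \<noteq> s)"
          then have "t \<subseteq> q" using that st by blast
          moreover have "q \<notin> X" using calculation tX collapsible_downward_closed[OF assms(1)] by blast
          ultimately show False using top[of q] that by blast
        qed
        ultimately show ?thesis by blast
      qed
      show "insert x q \<in> ?Z \<and> q - {x} \<notin> X" if q: "q \<in> ?Z - X" for q
      proof -
        have "insert x q \<noteq> t" using xt by blast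
        moreover have "insert x q \<noteq> s"
        proof
          assume "insert x q = s"
          then have "q = s \<or> q = t" using st xt by (cases "x \<in> q") auto
          then show False using q by blast
        qed
        ultimately show ?thesis using less.prems(5)[of q] q by blast
      qed
    qed
    then have "collapsible (insert t (insert (insert x t) ?Z))"
    proof (rule collapsible.expand)
      show "finite t" using fs st by simp
      show "x \<notin> t" by (rule xt)
      show "t \<notin> ?Z" by simp
      show "r \<in> ?Z" if "r \<subset> insert x t" "r \<noteq> t" for r
        using that less.prems(4)[of s r] s st by blast
    qed
    also have "insert t (insert (insert x t) ?Z) = Y" using s tX st by blast
    finally show ?thesis .
  qed
qed

text \<open>Gluing the join of a simplex \<open>e\<close> with a collapsible \<open>A\<close> to \<open>X\<close> along the join of the boundary of \<open>e\<close>
  with \<open>A\<close>: each expansion in the construction of \<open>A\<close> remains one after joining both of its faces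
  with \<open>e\<close>.\<close>

lemma collapsible_attach:
  assumes "collapsible A" "collapsible X" "finite e" "e \<inter> \<Union>A = {}"
    and "\<And>r. r \<in> A \<Longrightarrow> e \<union> r \<notin> X" "\<And>e' r. e' \<subset> e \<Longrightarrow> r \<in> A \<Longrightarrow> e' \<union> r \<in> X"
  shows "collapsible (X \<union> (\<union>) e ` A)"
  using assms(1,4-)
proof (induction A rule: collapsible.induct)
  case void
  then show ?case using assms(2) by simp
next
  case (expand A t x)
  have disj: "e \<inter> insert x t = {}" using expand.prems(1) by blast
  have IH: "collapsible (X \<union> (\<union>) e ` A)"
  proof (rule expand.IH)
    show "e \<inter> \<Union> A = {}" using expand.prems(1) by blast
    show "e \<union> r \<notin> X" if "r \<in> A" for r using expand.prems(2) that by blast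
    show "e' \<union> r \<in> X" if "e' \<subset> e" "r \<in> A" for e' r using expand.prems(3) that by blast
  qed
  have "collapsible (insert (e \<union> t) (insert (insert x (e \<union> t)) (X \<union> (\<union>) e ` A)))"
  proof (rule collapsible.expand[OF IH])
    show "finite (e \<union> t)" using assms(3) expand.hyps by simp
    show "x \<notin> e \<union> t" using disj expand.hyps by blast
    have "e \<union> t \<notin> (\<union>) e ` A"
    proof
      assume "e \<union> t \<in> (\<union>) e ` A"
      then obtain s where s: "s \<in> A" "e \<union> t = e \<union> s" by blast
      then have "t \<subseteq> s" using disj by blast
      then show False using collapsible_downward_closed s expand.hyps by blast
    qed
    then show "e \<union> t \<notin> X \<union> (\<union>) e ` A"
      using expand.prems(2) by blast
    show "r \<in> X \<union> (\<union>) e ` A" if r: "r \<subset> insert x (e \<union> t)" "r \<noteq> e \<union> t" for r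
    proof (cases "e \<subseteq> r")
      case True
      let ?s = "r - e"
      have "?s \<subset> insert x t" "?s \<noteq> t" using r True by blast+
      then have "?s \<in> A" using expand.hyps by blast
      then have "e \<union> ?s \<in> (\<union>) e ` A" by blast
      with True show ?thesis by (simp add: Un_absorb1)
    next
      case False
      let ?s = "r \<inter> insert x t"
      have "?s \<subset> insert x t \<and> ?s \<noteq> t \<or> ?s = t \<or> ?s = insert x t" by blast
      then have "?s \<in> insert t (insert (insert x t) A)" using expand.hyps(5)[of ?s] by blast
      then have "(r \<inter> e) \<union> ?s \<in> X" using expand.prems(3)[of "r \<inter> e" ?s] False by blast
      moreover have "(r \<inter> e) \<union> ?s = r" using r by blast
      ultimately show ?thesis by simp
    qed
  qed
  then show ?case by (simp add: insert_commute)
qed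

section \<open>Faces without a path on three vertices\<close>

definition adj :: "'v graph \<Rightarrow> 'v \<Rightarrow> 'v \<Rightarrow> bool" where
  "adj G x y \<longleftrightarrow> {x, y} \<in> edges G"

lemma adj_sym: "adj G x y \<longleftrightarrow> adj G y x"
  by (simp add: adj_def insert_commute)

lemma adj_irrefl: "fin_graph G \<Longrightarrow> \<not> adj G x x"
  by (auto simp: adj_def fin_graph_def)

definition path3 :: "'v \<Rightarrow> 'v \<Rightarrow> 'v \<Rightarrow> 'v graph" where
  "path3 x y z = ({x, y, z}, {{x, y}, {y, z}})"

text \<open>The devoid complex of the subgraph induced on \<open>U\<close>, in terms of adjacency; letting \<open>U\<close> vary
  avoids passing to subgraphs in the induction.\<close>

definition P3_free_faces :: "'v graph \<Rightarrow> 'v set \<Rightarrow> 'v set set" where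
  "P3_free_faces G U =
     {S. S \<subseteq> U \<and> (\<forall>x\<in>S. \<forall>y\<in>S. \<forall>z\<in>S. x \<noteq> z \<longrightarrow> \<not> (adj G x y \<and> adj G y z))}"

lemma P3_free_facesI:
  "S \<subseteq> U \<Longrightarrow> (\<And>x y z. x \<in> S \<Longrightarrow> y \<in> S \<Longrightarrow> z \<in> S \<Longrightarrow> adj G x y \<Longrightarrow> adj G y z \<Longrightarrow> x = z) \<Longrightarrow>
     S \<in> P3_free_faces G U"
  unfolding P3_free_faces_def by blast

lemma P3_free_facesD:
  assumes "S \<in> P3_free_faces G U"
  shows "S \<subseteq> U" "x \<in> S \<Longrightarrow> y \<in> S \<Longrightarrow> z \<in> S \<Longrightarrow> adj G x y \<Longrightarrow> adj G y z \<Longrightarrow> x = z"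
  using assms unfolding P3_free_faces_def by blast+

lemma path_graph_3: "path_graph 3 = path3 0 1 2"
proof -
  have "Suc i < 3 \<longleftrightarrow> i = 0 \<or> i = 1" for i
    by linarith
  then have "{{i, Suc i} |i. Suc i < 3} = {{0, Suc 0}, {1, Suc 1}}"
    by (simp only:) blast
  moreover have "{..<3::nat} = {0, 1, 2}" by auto
  ultimately show ?thesis
    unfolding path_graph_def path3_def by (simp add: numeral_2_eq_2)
qed

lemma graph_iso_path_graph_3:
  assumes "fin_graph C"
  shows "graph_iso C (path_graph 3) \<longleftrightarrow>
           (\<exists>x y z. x \<noteq> y \<and> y \<noteq> z \<and> x \<noteq> z \<and> C = path3 x y z)"
proof
  assume "graph_iso C (path_graph 3)"
  then obtain f where f: "bij_betw f (verts C) {0, 1, 2::nat}"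
      and fe: "{{0, 1}, {1, 2}} = (`) f ` edges C"
    by (auto simp: graph_iso_def path_graph_3 path3_def)
  define g where "g = inv_into (verts C) f"
  have g: "bij_betw g {0, 1, 2} (verts C)" using f by (simp add: g_def bij_betw_inv_into)
  have gf: "g ` f ` e = e" if "e \<in> edges C" for e
  proof -
    have "e \<subseteq> verts C" using that assms by (auto simp: fin_graph_def)
    then show ?thesis
      using f by (simp add: g_def bij_betw_def)
  qed
  have "verts C = {g 0, g 1, g 2}" using g by (auto simp: bij_betw_def)
  moreover have "edges C = (\<lambda>e. g ` f ` e) ` edges C" using gf by simp
  then have "edges C = (`) g ` {{0, 1}, {1, 2}}" unfolding fe by (simp add: image_image)
  then have "edges C = {{g 0, g 1}, {g 1, g 2}}" by simp
  moreover have "g 0 \<noteq> g 1" "g 1 \<noteq> g 2" "g 0 \<noteq> g 2" using g by (auto simp: bij_betw_def)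
  ultimately show "\<exists>x y z. x \<noteq> y \<and> y \<noteq> z \<and> x \<noteq> z \<and> C = path3 x y z"
    unfolding path3_def by (metis prod.collapse)
next
  assume "\<exists>x y z. x \<noteq> y \<and> y \<noteq> z \<and> x \<noteq> z \<and> C = path3 x y z"
  then obtain x y z where xyz: "x \<noteq> y" "y \<noteq> z" "x \<noteq> z" and C: "C = path3 x y z" by blast
  define f where "f w = (if w = x then 0 else if w = y then 1 else (2::nat))" for w
  have f: "f x = 0" "f y = 1" "f z = 2" using xyz by (simp_all add: f_def)
  have "verts C = {x, y, z}" by (simp add: C path3_def)
  then have bij: "bij_betw f (verts C) (verts (path3 0 1 2))"
    using f unfolding bij_betw_def inj_on_def by (simp add: path3_def)
  have im: "edges (path3 0 1 2) = (`) f ` edges C"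
    unfolding C path3_def snd_conv image_insert image_empty f by (rule refl)
  show "graph_iso C (path_graph 3)"
    unfolding graph_iso_def path_graph_3 by (rule exI[of _ f], rule conjI, rule bij, rule im)
qed

lemma path3_in_copies:
  assumes "fin_graph G"
  shows "C \<in> copies (path_graph 3) G \<longleftrightarrow>
     (\<exists>x y z. x \<noteq> z \<and> adj G x y \<and> adj G y z \<and> C = path3 x y z)"
proof -
  have *: "subgraph (path3 x y z) G \<longleftrightarrow> adj G x y \<and> adj G y z"
    if "x \<noteq> y" "y \<noteq> z" for x y z
    using that assms by (auto simp: subgraph_def path3_def adj_def fin_graph_def)
  have sub: "subgraph C G \<Longrightarrow> fin_graph C" by (simp add: subgraph_def)
  show ?thesis
  proof
    assume "C \<in> copies (path_graph 3) G"
    then have "subgraph C G" "graph_iso C (path_graph 3)" by (auto simp: copies_def)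
    then obtain x y z where "x \<noteq> y" "y \<noteq> z" "x \<noteq> z" "C = path3 x y z" "subgraph (path3 x y z) G"
      using graph_iso_path_graph_3[of C] sub by blast
    then show "\<exists>x y z. x \<noteq> z \<and> adj G x y \<and> adj G y z \<and> C = path3 x y z"
      using * by blast
  next
    assume "\<exists>x y z. x \<noteq> z \<and> adj G x y \<and> adj G y z \<and> C = path3 x y z"
    then obtain x y z where xyz: "x \<noteq> z" "adj G x y" "adj G y z" "C = path3 x y z" by blast
    then have "x \<noteq> y" "y \<noteq> z" using adj_irrefl[OF assms] by auto
    then have "subgraph C G" "graph_iso C (path_graph 3)"
      using * xyz graph_iso_path_graph_3[of C] sub by blast+
    then show "C \<in> copies (path_graph 3) G" by (simp add: copies_def)
  qed
qed

lemma devoid_complex_P3: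
  assumes "fin_graph G"
  shows "devoid_complex G (path_graph 3) = P3_free_faces G (verts G)"
proof -
  have "graph_free (path_graph 3) (induced_subgraph G S) \<longleftrightarrow>
      (\<forall>x\<in>S. \<forall>y\<in>S. \<forall>z\<in>S. x \<noteq> z \<longrightarrow> \<not> (adj G x y \<and> adj G y z))" for S
  proof -
    have fin: "fin_graph (induced_subgraph G S)"
      using assms by (auto simp: fin_graph_def induced_subgraph_def)
    have "adj (induced_subgraph G S) x y \<longleftrightarrow> x \<in> S \<and> y \<in> S \<and> adj G x y" for x y
      by (auto simp: adj_def induced_subgraph_def)
    moreover have "graph_free (path_graph 3) (induced_subgraph G S) \<longleftrightarrow>
        \<not> (\<exists>C. C \<in> copies (path_graph 3) (induced_subgraph G S))"
      by (auto simp: graph_free_def)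
    ultimately show ?thesis
      unfolding path3_in_copies[OF fin] by blast
  qed
  then show ?thesis unfolding devoid_complex_def P3_free_faces_def by presburger
qed

text \<open>A further path may be added to an induced matching when it is itself induced and no edge leads
  from it to the vertices already covered.\<close>

lemma induced_matching_insert:
  assumes G: "fin_graph G" and M: "induced_matching (path_graph 3) G M"
    and xyz: "adj G x y" "adj G y z" "x \<noteq> z" "\<not> adj G x z"
    and away: "\<And>w. w \<in> (\<Union>C\<in>M. verts C) \<Longrightarrow>
                 w \<notin> {x, y, z} \<and> \<not> adj G x w \<and> \<not> adj G y w \<and> \<not> adj G z w"
  shows "induced_matching (path_graph 3) G (insert (path3 x y z) M)"
  unfolding induced_matching_def
proof (intro conjI)
  let ?P = "path3 x y z" and ?W = "\<Union>C\<in>M. verts C"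
  have "?P \<in> copies (path_graph 3) G" unfolding path3_in_copies[OF G] using xyz by blast
  then show "insert ?P M \<subseteq> copies (path_graph 3) G"
    using M by (simp add: induced_matching_def)
  have vP: "verts ?P = {x, y, z}" "edges ?P = {{x, y}, {y, z}}" by (simp_all add: path3_def)
  have disj: "verts ?P \<inter> verts D = {}" "verts D \<inter> verts ?P = {}" if "D \<in> M" for D
    using away that unfolding vP by blast+
  have "\<forall>C\<in>M. \<forall>D\<in>M. C \<noteq> D \<longrightarrow> verts C \<inter> verts D = {}"
    using M by (simp add: induced_matching_def)
  then show "\<forall>C\<in>insert ?P M. \<forall>D\<in>insert ?P M. C \<noteq> D \<longrightarrow> verts C \<inter> verts D = {}"
    using disj by (simp del: disjoint_iff Int_iff)
  have ind: "edges (induced_subgraph G ?W) = (\<Union>C\<in>M. edges C)"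
    using M by (simp add: induced_matching_def)
  have eq: "e \<in> {{x, y}, {y, z}} \<or> e \<subseteq> ?W" if e: "e \<in> edges G" "e \<subseteq> {x, y, z} \<union> ?W" for e
  proof -
    obtain p q where pq: "e = {p, q}" "p \<noteq> q"
      using e G unfolding fin_graph_def by (metis card_2_iff)
    have adj: "adj G p q" "adj G q p" using e pq by (simp_all add: adj_def insert_commute)
    have "p \<in> ?W \<or> p \<in> {x, y, z}" "q \<in> ?W \<or> q \<in> {x, y, z}" using e(2) pq(1) by blast+
    then have "p \<in> ?W \<and> q \<in> ?W \<or> p \<in> {x, y, z} \<and> q \<in> {x, y, z}"
      using away[of p] away[of q] adj by blast
    then show ?thesis
    proof
      assume "p \<in> {x, y, z} \<and> q \<in> {x, y, z}"
      then have "{p, q} = {x, y} \<or> {p, q} = {y, z}"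
        using pq(2) adj xyz(4) adj_sym[of G x z] by blast
      then show ?thesis using pq(1) by simp
    qed (use pq(1) in blast)
  qed
  show "edges (induced_subgraph G (\<Union>C\<in>insert ?P M. verts C)) = (\<Union>C\<in>insert ?P M. edges C)"
  proof -
    have "edges (induced_subgraph G (\<Union>C\<in>insert ?P M. verts C))
        = {e \<in> edges G. e \<subseteq> {x, y, z} \<union> ?W}"
      by (simp add: induced_subgraph_def vP Un_commute)
    also have "\<dots> = {{x, y}, {y, z}} \<union> {e \<in> edges G. e \<subseteq> ?W}"
      using eq xyz(1,2) unfolding adj_def by blast
    also have "\<dots> = (\<Union>C\<in>insert ?P M. edges C)"
      using ind by (simp add: induced_subgraph_def vP)
    finally show ?thesis .
  qed
qed

lemma P3_free_faces_insert:
  assumes "S \<in> P3_free_faces G U" "fin_graph G" "w \<in> U" "\<And>y. y \<in> S \<Longrightarrow> \<not> adj G w y"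
  shows "insert w S \<in> P3_free_faces G U"
proof -
  have no: "\<not> adj G w y" "\<not> adj G y w" if "y \<in> insert w S" for y
    using that assms(4) adj_irrefl[OF assms(2)] adj_sym[of G w] by blast+
  have S: "S \<subseteq> U" "\<And>x y z. x \<in> S \<Longrightarrow> y \<in> S \<Longrightarrow> z \<in> S \<Longrightarrow> adj G x y \<Longrightarrow> adj G y z \<Longrightarrow> x = z"
    using P3_free_facesD[OF assms(1)] by blast+
  show ?thesis
  proof (rule P3_free_facesI)
    show "insert w S \<subseteq> U" using S(1) assms(3) by blast
    show "x = z" if "x \<in> insert w S" "y \<in> insert w S" "z \<in> insert w S" "adj G x y" "adj G y z" for x y z
      using that no[of x] no[of y] no[of z] S(2)[of x y z] by auto
  qed
qed

lemma P3_free_faces_down: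
  assumes "S \<in> P3_free_faces G U" "R \<subseteq> S"
  shows "R \<in> P3_free_faces G U"
proof (rule P3_free_facesI)
  show "R \<subseteq> U" using P3_free_facesD(1)[OF assms(1)] assms(2) by (rule order_trans[rotated])
  show "x = z" if "x \<in> R" "y \<in> R" "z \<in> R" "adj G x y" "adj G y z" for x y z
    using P3_free_facesD(2)[OF assms(1), of x y z] that assms(2) by (simp add: subset_iff)
qed

lemma P3_free_faces_mono: "U \<subseteq> V \<Longrightarrow> P3_free_faces G U \<subseteq> P3_free_faces G V"
  unfolding P3_free_faces_def by (simp add: Collect_mono_iff) (meson order_trans)

lemma P3_free_faces_finite:
  "finite U \<Longrightarrow> finite (P3_free_faces G U)" "finite U \<Longrightarrow> S \<in> P3_free_faces G U \<Longrightarrow> finite S"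
proof -
  have "P3_free_faces G U \<subseteq> Pow U" by (auto simp: P3_free_faces_def)
  then show "finite U \<Longrightarrow> finite (P3_free_faces G U)"
      "finite U \<Longrightarrow> S \<in> P3_free_faces G U \<Longrightarrow> finite S"
    by (meson finite_Pow_iff finite_subset PowD subsetD)+
qed

section \<open>Critical facets and induced matchings\<close>

text \<open>The induction described at the beginning.  The hypothesis on the sets \<open>W\<close> says that every induced subgraph on
  a nonempty subset of \<open>U\<close> has a vertex of degree at most one.\<close>

lemma collapsible_plus_critical_facets:
  assumes G: "fin_graph G" and "finite U"
    and "\<And>W. W \<subseteq> U \<Longrightarrow> W \<noteq> {} \<Longrightarrow> \<exists>w\<in>W. \<forall>x\<in>W. \<forall>y\<in>W. adj G w x \<longrightarrow> adj G w y \<longrightarrow> x = y"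
  shows "\<exists>A \<subseteq> P3_free_faces G U. collapsible A \<and>
     (\<forall>s \<in> P3_free_faces G U - A.
        (\<forall>t \<in> P3_free_faces G U. s \<subseteq> t \<longrightarrow> t = s) \<and>
        (\<exists>M. finite M \<and> induced_matching (path_graph 3) G M \<and>
             (\<Union>C\<in>M. verts C) \<subseteq> U \<and> card s = 2 * card M))"
  using assms(2,3)
proof (induction "card U" arbitrary: U rule: less_induct)
  case less
  let ?D = "P3_free_faces G" and ?adj = "adj G"
  note finU = \<open>finite U\<close>
  note irr = adj_irrefl[OF G]
  show ?case
  proof (cases "U = {}")
    case True
    have D: "?D U = {{}}" unfolding True P3_free_faces_def by auto
    have M: "finite {} \<and> induced_matching (path_graph 3) G {} \<and>
        (\<Union>C\<in>{}. verts C) \<subseteq> U \<and> card {} = 2 * card {}"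
      using G by (auto simp: induced_matching_def induced_subgraph_def fin_graph_def)
    show ?thesis
      unfolding D
    proof (rule exI[of _ "{}"], intro conjI ballI)
      fix s assume "s \<in> {{}} - {}"
      then have s: "s = {}" by simp
      show "s \<subseteq> t \<longrightarrow> t = s" if "t \<in> {{}}" for t using that s by simp
      show "\<exists>M. finite M \<and> induced_matching (path_graph 3) G M \<and>
          (\<Union>C\<in>M. verts C) \<subseteq> U \<and> card s = 2 * card M"
        unfolding s by (rule exI, rule M)
    qed (simp_all add: collapsible.void)
  next
    case False
    obtain a where a: "a \<in> U" "\<And>x y. x \<in> U \<Longrightarrow> y \<in> U \<Longrightarrow> ?adj a x \<Longrightarrow> ?adj a y \<Longrightarrow> x = y"
      using less.prems(2)[OF order_refl False] by blast
    show ?thesis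
    proof (cases "\<exists>v\<in>U. ?adj a v")
      case no_nbr: False
      have "collapsible (?D U)"
      proof (rule collapsible_toggle[OF collapsible.void, where x = a])
        show "insert a s \<in> ?D U \<and> s - {a} \<notin> {}" if "s \<in> ?D U - {}" for s
          using that no_nbr a P3_free_faces_insert[OF _ G, of s U a]
            P3_free_facesD(1)[of s G U] by blast
        show "finite (?D U)" by (rule P3_free_faces_finite(1)[OF finU])
        show "finite s" if "s \<in> ?D U" for s by (rule P3_free_faces_finite(2)[OF finU that])
        show "r \<in> ?D U" if "s \<in> ?D U" "r \<subseteq> s" for s r by (rule P3_free_faces_down[OF that])
      qed simp
      then show ?thesis by (intro exI[of _ "?D U"]) simp
    next
      case True
      then obtain v where v: "v \<in> U" "?adj a v" by blast
      have nbr_a: "x = v" if "x \<in> U" "?adj a x" for x using a v that by blast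
      have va: "v \<noteq> a" using v irr by blast
      define N where "N = {u \<in> U. ?adj v u} - {a}"
      define R where "R u = {y \<in> U. y \<noteq> v \<and> \<not> ?adj v y \<and> \<not> ?adj u y}" for u
      have finN: "finite N" using finU by (simp add: N_def)
      have "\<exists>A \<subseteq> ?D (R u). collapsible A \<and> (\<forall>s \<in> ?D (R u) - A.
              (\<forall>t \<in> ?D (R u). s \<subseteq> t \<longrightarrow> t = s) \<and>
              (\<exists>M. finite M \<and> induced_matching (path_graph 3) G M \<and>
                  (\<Union>C\<in>M. verts C) \<subseteq> R u \<and> card s = 2 * card M))" for u
      proof (rule less.hyps)
        show "card (R u) < card U"
          using v(1) finU by (intro psubset_card_mono) (auto simp: R_def)
        show "finite (R u)" using finU by (simp add: R_def)
        have "R u \<subseteq> U" by (auto simp: R_def)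
        then show "\<exists>w\<in>W. \<forall>x\<in>W. \<forall>y\<in>W. adj G w x \<longrightarrow> adj G w y \<longrightarrow> x = y"
          if "W \<subseteq> R u" "W \<noteq> {}" for W
          using less.prems(2) that by (meson subset_trans)
      qed
      then obtain A where A: "\<And>u. A u \<subseteq> ?D (R u)" "\<And>u. collapsible (A u)"
        and max: "\<And>u s t. s \<in> ?D (R u) - A u \<Longrightarrow> t \<in> ?D (R u) \<Longrightarrow> s \<subseteq> t \<Longrightarrow> t = s"
        and M: "\<And>u s. s \<in> ?D (R u) - A u \<Longrightarrow>
           \<exists>M. finite M \<and> induced_matching (path_graph 3) G M \<and>
                  (\<Union>C\<in>M. verts C) \<subseteq> R u \<and> card s = 2 * card M"
        by metis
      \<comment> \<open>Within \<open>A0\<close> the leaf \<open>a\<close> can always be added: its only neighbour \<open>v\<close>, if present, has no other.\<close>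
      define A0 where "A0 = {S \<in> ?D U. v \<in> S \<longrightarrow> S \<inter> N = {}}"
      have A0: "collapsible A0"
      proof (rule collapsible_toggle[OF collapsible.void, where x = a])
        show "insert a S \<in> A0 \<and> S - {a} \<notin> {}" if "S \<in> A0 - {}" for S
        proof -
          have S: "S \<in> ?D U" "v \<in> S \<Longrightarrow> S \<inter> N = {}"
            using that by (simp_all add: A0_def)
          then have SU: "S \<subseteq> U" using P3_free_facesD(1) by blast
          have "x = z" if xyz: "x \<in> insert a S" "y \<in> insert a S" "z \<in> insert a S"
            "?adj x y" "?adj y z" for x y z
          proof -
            have U: "x \<in> U" "y \<in> U" "z \<in> U" using xyz SU a(1) by auto
            consider "y = a" | "y \<noteq> a" "x = a" | "y \<noteq> a" "z = a" | "y \<in> S" "x \<in> S" "z \<in> S"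
              using xyz by blast
            then show ?thesis
            proof cases
              case 1
              then show ?thesis using nbr_a U xyz adj_sym[of G x y] by blast
            next
              case 2
              then have "y = v" using nbr_a xyz U by blast
              then show ?thesis using 2 xyz S(2) U by (auto simp: N_def)
            next
              case 3
              then have "y = v" using nbr_a xyz U adj_sym[of G y z] by blast
              then show ?thesis using 3 xyz S(2) U adj_sym[of G x y] by (auto simp: N_def)
            next
              case 4
              then show ?thesis using P3_free_facesD(2)[OF S(1)] xyz by blast
            qed
          qed
          moreover have "insert a S \<subseteq> U" using SU a(1) by blast
          ultimately have "insert a S \<in> ?D U" using P3_free_facesI by metis
          then show ?thesis using S(2) va by (auto simp: A0_def N_def)
        qed
        show "r \<in> A0" if "s \<in> A0" "r \<subseteq> s" for s r
          using that P3_free_faces_down[of s G U r] unfolding A0_def by blast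
        have sub: "A0 \<subseteq> ?D U" by (simp add: A0_def)
        then show "finite A0" by (rule finite_subset[OF _ P3_free_faces_finite(1)[OF finU]])
        show "finite s" if "s \<in> A0" for s
          using P3_free_faces_finite(2)[OF finU] sub that by blast
      qed simp
      have R_U: "?D (R u) \<subseteq> ?D U" for u by (intro P3_free_faces_mono) (auto simp: R_def)
      have N: "u \<in> U" "?adj v u" "?adj u v" "u \<noteq> v" "u \<noteq> a" if "u \<in> N" for u
        using that irr adj_sym[of G u v] by (auto simp: N_def)
      have nR: "v \<notin> r" "r \<inter> N = {}" "u \<in> N \<Longrightarrow> u \<notin> r"
        "y \<in> r \<Longrightarrow> \<not> ?adj v y \<and> \<not> ?adj u y \<and> \<not> ?adj y v \<and> \<not> ?adj y u"
        if "r \<in> ?D (R u)" for r u y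
        using P3_free_facesD(1)[OF that] adj_sym[of G y] by (auto simp: R_def N_def)
      have AD: "r \<in> ?D (R u)" if "r \<in> A u" for r u using A(1) that by blast
      have A': "collapsible (A0 \<union> (\<Union>u\<in>N'. (\<union>) {v, u} ` A u))" if "N' \<subseteq> N" for N'
        using finite_subset[OF that finN] that
      proof (induction N' rule: finite_induct)
        case empty
        then show ?case using A0 by simp
      next
        case (insert u N')
        let ?X = "A0 \<union> (\<Union>u\<in>N'. (\<union>) {v, u} ` A u)"
        have u: "u \<in> N" "N' \<subseteq> N" using insert.prems by auto
        have "collapsible (?X \<union> (\<union>) {v, u} ` A u)"
        proof (rule collapsible_attach)
          show "collapsible (A u)" by (rule A)
          show "collapsible ?X" using insert by blast
          show "finite {v, u}" by simp
          show "{v, u} \<inter> \<Union> (A u) = {}"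
            using nR(1)[OF AD] nR(3)[OF AD u(1)] by auto
          show "{v, u} \<union> r \<notin> ?X" if r: "r \<in> A u" for r
          proof -
            have "{v, u} \<union> r \<notin> A0" using u by (auto simp: A0_def)
            moreover have "{v, u} \<union> r \<noteq> {v, u'} \<union> r'" if "u' \<in> N'" "r' \<in> A u'" for u' r'
            proof -
              have "u \<notin> r'" using nR(2)[OF AD[OF that(2)]] u by blast
              moreover have "u \<noteq> u'" using that insert.hyps by blast
              ultimately show ?thesis using N[OF u(1)] by blast
            qed
            ultimately show ?thesis by blast
          qed
          show "e' \<union> r \<in> ?X" if e': "e' \<subset> {v, u}" and r: "r \<in> A u" for e' r
          proof -
            have r': "r \<in> ?D (R u)" "r \<in> ?D U" using AD[OF r] R_U by blast+
            have "e' = {} \<or> e' = {v} \<or> e' = {u}" using e' by blast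
            then have "e' \<union> r \<in> A0"
            proof (elim disjE)
              assume "e' = {}"
              then show ?thesis using r' nR(1)[OF r'(1)] by (simp add: A0_def)
            next
              assume e: "e' = {v}"
              have "insert v r \<in> ?D U"
                using P3_free_faces_insert[OF r'(2) G v(1)] nR(4)[OF r'(1)] by blast
              then show ?thesis using e nR(2)[OF r'(1)] irr by (auto simp: A0_def N_def)
            next
              assume e: "e' = {u}"
              have "insert u r \<in> ?D U"
                using P3_free_faces_insert[OF r'(2) G N(1)[OF u(1)]] nR(4)[OF r'(1)] by blast
              then show ?thesis using e nR(1)[OF r'(1)] N(4)[OF u(1)] by (auto simp: A0_def)
            qed
            then show ?thesis by blast
          qed
        qed
        then show ?case by (simp add: Un_ac)
      qed
      let ?A = "A0 \<union> (\<Union>u\<in>N. (\<union>) {v, u} ` A u)"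
      have link: "S - {v, u} \<in> ?D (R u)" if "S \<in> ?D U" "v \<in> S" "u \<in> S" "u \<in> N" for S u
      proof -
        note P = P3_free_facesD(2)[OF that(1)]
        show ?thesis
        proof (rule P3_free_facesI)
          show "S - {v, u} \<subseteq> R u"
            using that(2,3) N(2,3)[OF that(4)] P[of u v] P[of v u] P3_free_facesD(1)[OF that(1)]
            unfolding R_def by blast
          show "x = z" if "x \<in> S - {v, u}" "y \<in> S - {v, u}" "z \<in> S - {v, u}"
              "?adj x y" "?adj y z" for x y z
            using P[of x y z] that by simp
        qed
      qed
      have unlink: "{v, u} \<union> r \<in> ?D U" if "r \<in> ?D (R u)" "u \<in> N" for r u
      proof -
        note r = P3_free_facesD(2)[OF that(1)]
        have "x = z" if "x \<in> {v, u} \<union> r" "y \<in> {v, u} \<union> r" "z \<in> {v, u} \<union> r"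
            "?adj x y" "?adj y z" for x y z
          using that nR(4)[OF \<open>r \<in> ?D (R u)\<close>] irr r by blast
        moreover have "{v, u} \<union> r \<subseteq> U"
          using that v(1) N(1)[OF that(2)] P3_free_facesD(1)[of r G U] R_U by blast
        ultimately show ?thesis using P3_free_facesI by metis
      qed
      have "(\<forall>t \<in> ?D U. s \<subseteq> t \<longrightarrow> t = s) \<and>
        (\<exists>M. finite M \<and> induced_matching (path_graph 3) G M \<and>
             (\<Union>C\<in>M. verts C) \<subseteq> U \<and> card s = 2 * card M)" if s: "s \<in> ?D U - ?A" for s
      proof -
        obtain u where u: "v \<in> s" "u \<in> s" "u \<in> N" using s by (auto simp: A0_def)
        let ?r = "s - {v, u}"
        have "{v, u} \<union> ?r = s" using u by blast
        then have r: "?r \<in> ?D (R u) - A u" using s link[of s u] u by blast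
        have "t = s" if "t \<in> ?D U" "s \<subseteq> t" for t
        proof -
          have "t - {v, u} = ?r" using max[OF r, of "t - {v, u}"] link[of t u] that u by blast
          then show ?thesis using that u by blast
        qed
        moreover obtain M where M: "finite M" "induced_matching (path_graph 3) G M"
            "(\<Union>C\<in>M. verts C) \<subseteq> R u" "card ?r = 2 * card M"
          using M[OF r] by blast
        let ?P = "path3 a v u"
        have au: "\<not> ?adj a u" using nbr_a N(1,4)[OF u(3)] by blast
        have "induced_matching (path_graph 3) G (insert ?P M)"
        proof (rule induced_matching_insert[OF G M(2) v(2)])
          show "?adj v u" "a \<noteq> u" using N(2,5)[OF u(3)] by auto
          show "\<not> ?adj a u" by (rule au)
          show "w \<notin> {a, v, u} \<and> \<not> ?adj a w \<and> \<not> ?adj v w \<and> \<not> ?adj u w"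
            if "w \<in> (\<Union>C\<in>M. verts C)" for w
          proof -
            have w: "w \<in> U" "w \<noteq> v" "\<not> ?adj v w" "\<not> ?adj u w" using that M(3) by (auto simp: R_def)
            then show ?thesis using nbr_a v(2) adj_sym[of G a v] N(2)[OF u(3)] by blast
          qed
        qed
        moreover have "(\<Union>C\<in>insert ?P M. verts C) \<subseteq> U"
          using M(3) a(1) v(1) N(1)[OF u(3)] by (auto simp: path3_def R_def)
        moreover have "?P \<notin> M"
        proof
          assume "?P \<in> M"
          then have "v \<in> (\<Union>C\<in>M. verts C)" by (force simp: path3_def)
          then show False using M(3) by (auto simp: R_def)
        qed
        then have "card s = 2 * card (insert ?P M)"
        proof -
          have "finite s" using s P3_free_faces_finite(2)[OF finU] by blast
          have "{v, u} \<subseteq> s" using u by blast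
          moreover have "card {v, u} = 2" using N(4)[OF u(3)] by simp
          ultimately have "card s = card ?r + 2"
            using card_Diff_subset[of "{v, u}" s] card_mono[OF \<open>finite s\<close>, of "{v, u}"] by simp
          then show ?thesis using M \<open>?P \<notin> M\<close> by simp
        qed
        moreover have "finite (insert ?P M)" using M(1) by simp
        ultimately show ?thesis by (intro conjI exI[of _ "insert ?P M"] allI ballI impI)
      qed
      moreover have "?A \<subseteq> ?D U"
      proof -
        have "A0 \<subseteq> ?D U" by (simp add: A0_def)
        moreover have "(\<union>) {v, u} ` A u \<subseteq> ?D U" if "u \<in> N" for u
          using unlink[OF AD that] by blast
        ultimately show ?thesis by blast
      qed
      ultimately show ?thesis
        using A'[OF order_refl] by (intro exI[of _ ?A] conjI ballI) simp_all
    qed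
  qed
qed

text \<open>If every vertex of \<open>W\<close> had two neighbours in \<open>W\<close>, an end of a longest path in \<open>W\<close> would have a
  second neighbour, which lies on the path by maximality and closes a cycle.\<close>

lemma forest_sparse:
  assumes F: "forest F" and W: "W \<subseteq> verts F" "W \<noteq> {}"
  shows "\<exists>w\<in>W. \<forall>x\<in>W. \<forall>y\<in>W. adj F w x \<longrightarrow> adj F w y \<longrightarrow> x = y"
proof (rule ccontr)
  assume "\<not> ?thesis"
  then have two: "\<exists>x\<in>W. \<exists>y\<in>W. x \<noteq> y \<and> adj F w x \<and> adj F w y" if "w \<in> W" for w
    using that by blast
  have G: "fin_graph F" and nocyc: "\<And>c. \<not> is_cycle F c" using F by (auto simp: forest_def)
  have finW: "finite W" using W G by (auto simp: fin_graph_def intro: finite_subset)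
  define path where "path p \<longleftrightarrow> p \<noteq> [] \<and> distinct p \<and> set p \<subseteq> W \<and>
      (\<forall>i. Suc i < length p \<longrightarrow> adj F (p ! i) (p ! Suc i))" for p
  obtain w where "w \<in> W" using W by blast
  then have "path [w]" by (simp add: path_def)
  moreover have "\<forall>p. path p \<longrightarrow> length p < Suc (card W)"
    using finW card_mono distinct_card unfolding path_def by (metis less_Suc_eq_le)
  ultimately obtain p where p: "path p" and longest: "\<And>q. path q \<Longrightarrow> length q \<le> length p"
    using ex_has_greatest_nat[of path "[w]" length "Suc (card W)"] by blast
  have "hd p \<in> W" using p unfolding path_def by auto
  then obtain x where x: "x \<in> W" "adj F (hd p) x" "length p > 1 \<Longrightarrow> x \<noteq> p ! 1"
    using two by metis
  have "x \<in> set p"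
  proof (rule ccontr)
    assume "x \<notin> set p"
    have "adj F ((x # p) ! i) ((x # p) ! Suc i)" if "Suc i < length (x # p)" for i
      using that p x adj_sym[of F x "hd p"] unfolding path_def by (cases i) (auto simp: hd_conv_nth)
    then have "path (x # p)" using p x \<open>x \<notin> set p\<close> unfolding path_def by simp
    from longest[OF this] show False by simp
  qed
  then obtain j where j: "j < length p" "p ! j = x" by (auto simp: in_set_conv_nth)
  have h: "hd p = p ! 0" using p by (simp add: path_def hd_conv_nth)
  have "j \<noteq> 0" using x(2) j h adj_irrefl[OF G] by (metis)
  moreover have "j \<noteq> 1" using x(3) j by auto
  ultimately have j2: "2 \<le> j" by linarith
  let ?c = "take (Suc j) p"
  have len: "length ?c = Suc j" using j by simp
  have "{?c ! i, ?c ! (Suc i mod length ?c)} \<in> edges F" if i: "i < length ?c" for i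
  proof (cases "i = j")
    case True
    then show ?thesis using j x(2) h len by (simp add: adj_def insert_commute)
  next
    case False
    then have "Suc i < Suc j" using i len by simp
    then show ?thesis using p j len unfolding path_def adj_def by simp
  qed
  then have "is_cycle F ?c"
    using p j2 len W set_take_subset[of "Suc j" p] unfolding is_cycle_def path_def by auto
  with nocyc show False by blast
qed

section \<open>Realizations and contractibility of collapsible complexes\<close>

lemma continuous_map_Min:
  assumes "finite S" "S \<noteq> {}" "\<And>v. v \<in> S \<Longrightarrow> continuous_map X euclideanreal (\<lambda>x. f x v)"
  shows "continuous_map X euclideanreal (\<lambda>x. Min (f x ` S))"
  using assms
proof (induction S rule: finite_ne_induct)
  case (insert v S)
  have "continuous_map X euclideanreal (\<lambda>x. min (f x v) (Min (f x ` S)))"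
    using insert by (intro continuous_map_real_min) auto
  then show ?case using insert.hyps by simp
qed simp

lemma continuous_map_powertop_component:
  "v \<in> V \<Longrightarrow> continuous_map (subtopology (powertop_real V) T) euclideanreal (\<lambda>x. x v)"
  by (intro continuous_map_from_subtopology continuous_map_product_projection)

definition closed_simplex :: "'v set \<Rightarrow> 'v set \<Rightarrow> ('v \<Rightarrow> real) set" where
  "closed_simplex V s =
     {x \<in> extensional V. (\<forall>v\<in>V. 0 \<le> x v) \<and> (\<Sum>v\<in>V. x v) = 1 \<and> (\<forall>v\<in>V - s. x v = 0)}"

lemma topspace_powertop_real: "topspace (powertop_real V) = extensional V"
  by (auto simp: PiE_def)

lemma closedin_closed_simplex:
  assumes "finite V" shows "closedin (powertop_real V) (closed_simplex V s)"
proof (cases "V = {}")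
  case True
  then show ?thesis by (simp add: closed_simplex_def)
next
  case False
  let ?P = "powertop_real V"
  have "closed_simplex V s = {x \<in> topspace ?P. (\<Sum>v\<in>V. x v) \<in> {1}} \<inter>
      (\<Inter>v\<in>V. {x \<in> topspace ?P. x v \<in> (if v \<in> s then {0..} else {0})})"
  proof -
    have "x v \<in> (if v \<in> s then {0..} else {0}) \<longleftrightarrow> 0 \<le> x v \<and> (v \<in> s \<or> x v = 0)"
      for x :: "'a \<Rightarrow> real" and v
      by auto
    then show ?thesis
      unfolding closed_simplex_def topspace_powertop_real using False
      by (simp only:) blast
  qed
  moreover have "closedin ?P {x \<in> topspace ?P. (\<Sum>v\<in>V. x v) \<in> {1}}"
    using assms by (intro closedin_continuous_map_preimage[where Y = euclideanreal] continuous_map_sum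
        continuous_map_product_projection) auto
  moreover have "closedin ?P (\<Inter>v\<in>V. {x \<in> topspace ?P. x v \<in> (if v \<in> s then {0..} else {0})})"
    using False by (intro closedin_INT closedin_continuous_map_preimage[where Y = euclideanreal]
        continuous_map_product_projection) auto
  ultimately show ?thesis by (simp only: closedin_Int)
qed

definition support :: "'v set \<Rightarrow> ('v \<Rightarrow> real) \<Rightarrow> 'v set" where
  "support V x = {v \<in> V. x v \<noteq> 0}"

text \<open>The ambient set \<open>V\<close> of coordinates is kept apart from the complex, so that the realization of a
  subcomplex is literally a subspace.\<close>

definition realization_points :: "'v set \<Rightarrow> 'v set set \<Rightarrow> ('v \<Rightarrow> real) set" where
  "realization_points V K =
     {x \<in> extensional V. (\<forall>v\<in>V. 0 \<le> x v) \<and> (\<Sum>v\<in>V. x v) = 1 \<and> support V x \<in> K}"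

definition realization :: "'v set \<Rightarrow> 'v set set \<Rightarrow> ('v \<Rightarrow> real) topology" where
  "realization V K = subtopology (powertop_real V) (realization_points V K)"

lemma geometric_realization_eq: "geometric_realization K = realization (\<Union>K) K"
proof -
  have "realization_points (\<Union>K) K = extensional (\<Union>K) \<inter>
      {x. (\<forall>v\<in>\<Union>K. 0 \<le> x v) \<and> (\<Sum>v\<in>\<Union>K. x v) = 1 \<and> {v \<in> \<Union>K. x v \<noteq> 0} \<in> K}"
    unfolding realization_points_def support_def by blast
  then show ?thesis
    unfolding geometric_realization_def realization_def topspace_powertop_real[symmetric]
    by (simp only: subtopology_restrict)
qed

lemma topspace_realization [simp]: "topspace (realization V K) = realization_points V K"
proof -
  have "realization_points V K \<subseteq> extensional V" by (simp add: realization_points_def)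
  then show ?thesis unfolding realization_def topspace_subtopology topspace_powertop_real by (rule Int_absorb1)
qed

lemma realization_pointsI:
  assumes "x \<in> extensional V" "\<And>v. v \<in> V \<Longrightarrow> 0 \<le> x v" "(\<Sum>v\<in>V. x v) = 1" "support V x \<in> K"
  shows "x \<in> realization_points V K"
  using assms by (simp add: realization_points_def)

lemma realization_pointsD:
  assumes "x \<in> realization_points V K"
  shows "x \<in> extensional V" "v \<in> V \<Longrightarrow> 0 \<le> x v" "(\<Sum>v\<in>V. x v) = 1" "support V x \<in> K"
  using assms by (simp_all add: realization_points_def)

lemma realization_points_mono: "A \<subseteq> K \<Longrightarrow> realization_points V A \<subseteq> realization_points V K"
  unfolding realization_points_def by blast

lemma continuous_map_realization_component:
  "v \<in> V \<Longrightarrow> continuous_map (realization V K) euclideanreal (\<lambda>x. x v)"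
  unfolding realization_def by (rule continuous_map_powertop_component)

lemma continuous_map_into_realization:
  assumes "\<And>v. v \<in> V \<Longrightarrow> continuous_map X euclideanreal (\<lambda>x. f x v)"
    and "\<And>x. x \<in> topspace X \<Longrightarrow> f x \<in> realization_points V K"
  shows "continuous_map X (realization V K) f"
  unfolding realization_def continuous_map_in_subtopology continuous_map_componentwise
  using assms realization_pointsD(1) by (fastforce simp: Pi_iff)

lemma subtopology_realization:
  "A \<subseteq> K \<Longrightarrow> subtopology (realization V K) (realization_points V A) = realization V A"
  unfolding realization_def subtopology_subtopology
  by (simp add: Int_absorb1 realization_points_mono)

lemma closedin_realization_points:
  assumes V: "finite V" and A: "finite A" "A \<subseteq> K" "\<And>s r. s \<in> A \<Longrightarrow> r \<subseteq> s \<Longrightarrow> r \<in> A"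
  shows "closedin (realization V K) (realization_points V A)"
proof -
  have "realization_points V A = (\<Union>s\<in>A. closed_simplex V s)"
  proof (intro set_eqI iffI)
    fix x assume x: "x \<in> realization_points V A"
    then have "x \<in> closed_simplex V (support V x)"
      using realization_pointsD[OF x] by (simp add: closed_simplex_def support_def)
    then show "x \<in> (\<Union>s\<in>A. closed_simplex V s)" using realization_pointsD(4)[OF x] by blast
  next
    fix x assume "x \<in> (\<Union>s\<in>A. closed_simplex V s)"
    then obtain s where s: "s \<in> A" "x \<in> closed_simplex V s" by blast
    then have "support V x \<subseteq> s" by (auto simp: support_def closed_simplex_def)
    then have "support V x \<in> A" using A(3) s(1) by blast
    then show "x \<in> realization_points V A"
      using s(2) by (simp add: closed_simplex_def realization_points_def)
  qed
  then have "closedin (powertop_real V) (realization_points V A)"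
    using A(1) closedin_closed_simplex[OF V] by (auto intro!: closedin_Union)
  then show ?thesis
    unfolding realization_def
    by (rule closedin_subset_topspace) (rule realization_points_mono[OF A(2)])
qed

definition segment :: "'v set \<Rightarrow> ('v \<Rightarrow> real) \<Rightarrow> ('v \<Rightarrow> real) \<Rightarrow> real \<Rightarrow> 'v \<Rightarrow> real" where
  "segment V x y t = (\<lambda>v\<in>V. (1 - t) * x v + t * y v)"

lemma segment_endpoints:
  "x \<in> extensional V \<Longrightarrow> segment V x y 0 = x" "y \<in> extensional V \<Longrightarrow> segment V x y 1 = y"
  by (auto simp: segment_def extensional_def)

lemma segment_same: "x \<in> extensional V \<Longrightarrow> segment V x x t = x"
  by (auto simp: segment_def extensional_def algebra_simps)

lemma segment_in_realization:
  assumes x: "x \<in> realization_points V K" and y: "y \<in> realization_points V K"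
    and t: "t \<in> {0..1}" and s: "support V x \<subseteq> s" "support V y \<subseteq> s" "s \<in> K"
    and down: "\<And>s r. s \<in> K \<Longrightarrow> r \<subseteq> s \<Longrightarrow> r \<in> K"
  shows "segment V x y t \<in> realization_points V K"
proof (rule realization_pointsI)
  show "segment V x y t \<in> extensional V" by (simp add: segment_def)
  show "0 \<le> segment V x y t v" if "v \<in> V" for v
    using realization_pointsD(2)[OF x that] realization_pointsD(2)[OF y that] t that
    by (simp add: segment_def)
  have "(\<Sum>v\<in>V. segment V x y t v) = (1 - t) * (\<Sum>v\<in>V. x v) + t * (\<Sum>v\<in>V. y v)"
    by (simp add: segment_def sum.distrib sum_distrib_left)
  then show "(\<Sum>v\<in>V. segment V x y t v) = 1"
    using realization_pointsD(3)[OF x] realization_pointsD(3)[OF y] by simp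
  have "support V (segment V x y t) \<subseteq> s"
  proof
    fix v assume v: "v \<in> support V (segment V x y t)"
    then have "v \<in> V" "x v \<noteq> 0 \<or> y v \<noteq> 0" by (auto simp: support_def segment_def)
    then show "v \<in> s" using s(1,2) by (auto simp: support_def)
  qed
  then show "support V (segment V x y t) \<in> K" using down s(3) by blast
qed

text \<open>The segment between two points of a realization stays inside whenever their supports lie in a
  common face.  The property \<open>P\<close> serves for homotopies that preserve a subspace.\<close>

lemma straight_line_homotopy:
  assumes f: "continuous_map X (realization V K) f" and g: "continuous_map X (realization V K) g"
    and common: "\<And>x. x \<in> topspace X \<Longrightarrow> \<exists>s\<in>K. support V (f x) \<subseteq> s \<and> support V (g x) \<subseteq> s"
    and down: "\<And>s r. s \<in> K \<Longrightarrow> r \<subseteq> s \<Longrightarrow> r \<in> K"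
    and P: "\<And>h k. (\<And>x. x \<in> topspace X \<Longrightarrow> h x = k x) \<Longrightarrow> P h \<longleftrightarrow> P k"
      "\<And>t. t \<in> {0..1} \<Longrightarrow> P (\<lambda>x. segment V (f x) (g x) t)"
  shows "homotopic_with P X (realization V K) f g"
proof (subst homotopic_with)
  show "P h \<longleftrightarrow> P k" if "\<And>x. x \<in> topspace X \<Longrightarrow> h x = k x" for h k using P(1) that by blast
  let ?h = "\<lambda>(t, x). segment V (f x) (g x) t" and ?I = "top_of_set {0..1::real}"
  have pts: "f x \<in> realization_points V K" "g x \<in> realization_points V K" if "x \<in> topspace X" for x
    using f g that continuous_map_image_subset_topspace by fastforce+
  have "continuous_map (prod_topology ?I X) (realization V K) ?h"
  proof (rule continuous_map_into_realization)
    fix v assume v: "v \<in> V"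
    have comp: "continuous_map (prod_topology ?I X) euclideanreal (\<lambda>p. k (snd p) v)"
      if "continuous_map X (realization V K) k" for k
      using continuous_map_compose[OF continuous_map_compose[OF continuous_map_snd that]
          continuous_map_realization_component[OF v]] by (simp add: o_def)
    have "continuous_map (prod_topology ?I X) euclideanreal fst"
      by (rule continuous_map_into_fulltopology[OF continuous_map_fst])
    then have "continuous_map (prod_topology ?I X) euclideanreal
        (\<lambda>p. (1 - fst p) * f (snd p) v + fst p * g (snd p) v)"
      by (intro continuous_map_add continuous_map_real_mult continuous_map_diff
          continuous_map_canonical_const comp[OF f] comp[OF g])
    then show "continuous_map (prod_topology ?I X) euclideanreal (\<lambda>p. ?h p v)"
      using v by (simp add: segment_def split_beta)
  next
    fix p assume "p \<in> topspace (prod_topology ?I X)"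
    then obtain t x where p: "p = (t, x)" "t \<in> {0..1}" "x \<in> topspace X" by auto
    obtain s where "s \<in> K" "support V (f x) \<subseteq> s" "support V (g x) \<subseteq> s" using common[OF p(3)] by blast
    then show "?h p \<in> realization_points V K"
      using segment_in_realization[OF pts[OF p(3)] p(2) _ _ _ down] p(1) by simp
  qed
  moreover have "?h (0, x) = f x" "?h (1, x) = g x" if "x \<in> topspace X" for x
    using segment_endpoints(1)[OF realization_pointsD(1)[OF pts(1)[OF that]]]
      segment_endpoints(2)[OF realization_pointsD(1)[OF pts(2)[OF that]]] by simp_all
  moreover have "P (\<lambda>x. ?h (t, x))" if "t \<in> {0..1}" for t using P(2)[OF that] by simp
  ultimately show "\<exists>h. continuous_map (prod_topology ?I X) (realization V K) h \<and>
      (\<forall>x\<in>topspace X. h (0, x) = f x) \<and> (\<forall>x\<in>topspace X. h (1, x) = g x) \<and>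
      (\<forall>t\<in>{0..1}. P (\<lambda>x. h (t, x)))"
    by (intro exI[of _ ?h] conjI ballI)
qed

text \<open>The simplex \<open>insert x t\<close> is pushed from its free face \<open>t\<close> onto the other faces: the smallest
  coordinate over \<open>t\<close> is subtracted from all coordinates in \<open>t\<close>, and the mass gained goes to \<open>x\<close>.
  That minimum vanishes exactly on points of the smaller complex, so a single formula covers the
  whole space and is the identity there.\<close>

lemma elementary_expansion_homotopy_equivalent:
  assumes V: "finite V" "insert x t \<subseteq> V" and xt: "x \<notin> t" "t \<noteq> {}" and tX: "t \<notin> X"
    and downX: "\<And>s r. s \<in> X \<Longrightarrow> r \<subseteq> s \<Longrightarrow> r \<in> X"
    and faces: "\<And>r. r \<subset> insert x t \<Longrightarrow> r \<noteq> t \<Longrightarrow> r \<in> X"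
  shows "realization V (insert t (insert (insert x t) X)) homotopy_equivalent_space realization V X"
proof -
  let ?K = "insert t (insert (insert x t) X)"
  have fint: "finite t" using finite_subset[OF V(2,1)] by simp
  have downK: "r \<in> ?K" if "s \<in> ?K" "r \<subseteq> s" for s r
  proof (cases "s \<in> X")
    case True
    then show ?thesis using downX that(2) by (meson insertCI)
  next
    case False
    then have "r \<subseteq> insert x t" using that by auto
    then have "r = insert x t \<or> r = t \<or> r \<in> X" using faces[of r] by (cases "r = insert x t") auto
    then show ?thesis by auto
  qed
  define m where "m y = Min (y ` t)" for y :: "'a \<Rightarrow> real"
  define \<rho> where "\<rho> y = (\<lambda>v\<in>V. y v + (if v \<in> t then - m y else if v = x then card t * m y else 0))"
    for y :: "'a \<Rightarrow> real"
  have mle: "m y \<le> y v" if "v \<in> t" for y v using that fint by (simp add: m_def)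
  have matt: "\<exists>v\<in>t. m y = y v" for y
  proof -
    have "m y \<in> y ` t" using fint xt(2) unfolding m_def by (intro Min_in) auto
    then show ?thesis by blast
  qed
  have m0: "0 \<le> m y" if "y \<in> realization_points V ?K" for y
    using matt[of y] realization_pointsD(2)[OF that] V(2) by auto
  have mX: "m y = 0" if y: "y \<in> realization_points V X" for y
  proof -
    have "\<not> t \<subseteq> support V y" using realization_pointsD(4)[OF y] downX tX by blast
    then obtain v where v: "v \<in> t" "y v = 0" using V(2) by (auto simp: support_def)
    have "m y \<le> 0" using mle[OF v(1), of y] v(2) by simp
    moreover have "0 \<le> m y"
      using m0 y realization_points_mono[of X ?K V] by blast
    ultimately show ?thesis by simp
  qed
  have \<rho>X: "\<rho> y = y" if y: "y \<in> realization_points V X" for y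
    using mX[OF y] realization_pointsD(1)[OF y] by (auto simp: \<rho>_def extensional_def)
  have \<rho>_in: "\<rho> y \<in> realization_points V X \<and> (support V y \<subseteq> s \<and> support V (\<rho> y) \<subseteq> s)"
    if y: "y \<in> realization_points V ?K" and s: "s = (if support V y \<in> X then support V y else insert x t)"
    for y s
  proof (cases "support V y \<in> X")
    case True
    then have "y \<in> realization_points V X" using y by (simp add: realization_points_def)
    then show ?thesis using \<rho>X s True by simp
  next
    case False
    then have supp: "support V y \<subseteq> insert x t" using realization_pointsD(4)[OF y] by blast
    have zero: "y v = 0" if "v \<in> V" "v \<notin> insert x t" for v
      using supp that unfolding support_def by blast
    have sub: "support V (\<rho> y) \<subseteq> insert x t"
      using zero by (auto simp: support_def \<rho>_def)
    have "\<rho> y \<in> realization_points V X"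
    proof (rule realization_pointsI)
      show "\<rho> y \<in> extensional V" by (simp add: \<rho>_def)
      show "0 \<le> \<rho> y v" if "v \<in> V" for v
        using mle[of v y] m0[OF y] realization_pointsD(2)[OF y that] that
        by (simp add: \<rho>_def)
      have "(\<Sum>v\<in>V. if v \<in> t then - m y else if v = x then card t * m y else 0)
          = (\<Sum>v\<in>insert x t. if v \<in> t then - m y else if v = x then card t * m y else 0)"
        using V by (intro sum.mono_neutral_right) auto
      also have "\<dots> = 0" using fint xt(1) by simp
      finally show "(\<Sum>v\<in>V. \<rho> y v) = 1"
        using realization_pointsD(3)[OF y] by (simp add: \<rho>_def sum.distrib)
      obtain v where v: "v \<in> t" "m y = y v" using matt by blast
      then have "v \<notin> support V (\<rho> y)" by (simp add: support_def \<rho>_def)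
      moreover have "support V (\<rho> y) \<noteq> t" using calculation v by blast
      ultimately show "support V (\<rho> y) \<in> X" using sub v faces by blast
    qed
    then show ?thesis using sub supp s False by simp
  qed
  have incl: "continuous_map (realization V X) (realization V ?K) id"
    using realization_points_mono[of X ?K V]
    by (intro continuous_map_into_realization) (auto intro: continuous_map_realization_component)
  have cont_m: "continuous_map (realization V ?K) euclideanreal m"
    unfolding m_def[abs_def] using fint xt(2) V(2)
    by (intro continuous_map_Min continuous_map_realization_component) auto
  have cont: "continuous_map (realization V ?K) (realization V X) \<rho>"
  proof (rule continuous_map_into_realization)
    fix v assume v: "v \<in> V"
    have c: "continuous_map (realization V ?K) euclideanreal
        (\<lambda>y. y v + (if v \<in> t then - 1 else if v = x then card t else 0) * m y)"
      by (intro continuous_map_add continuous_map_realization_component v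
          continuous_map_real_mult_left cont_m)
    have "(if v \<in> t then - 1 else if v = x then card t else 0) * m y =
        (if v \<in> t then - m y else if v = x then card t * m y else 0)" for y by simp
    then show "continuous_map (realization V ?K) euclideanreal (\<lambda>y. \<rho> y v)"
      using v c by (simp add: \<rho>_def)
  next
    fix y assume "y \<in> topspace (realization V ?K)"
    then show "\<rho> y \<in> realization_points V X" using \<rho>_in by simp
  qed
  have "homotopic_with (\<lambda>_. True) (realization V ?K) (realization V ?K) (id \<circ> \<rho>) id"
  proof (rule straight_line_homotopy)
    show "continuous_map (realization V ?K) (realization V ?K) (id \<circ> \<rho>)"
      by (rule continuous_map_compose[OF cont incl])
    fix y assume "y \<in> topspace (realization V ?K)"
    then have y: "y \<in> realization_points V ?K" by simp
    show "\<exists>s\<in>?K. support V ((id \<circ> \<rho>) y) \<subseteq> s \<and> support V (id y) \<subseteq> s"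
      using \<rho>_in[OF y refl] by (intro bexI[of _ "if support V y \<in> X then support V y else insert x t"]) auto
  qed (use downK in auto)
  moreover have "homotopic_with (\<lambda>_. True) (realization V X) (realization V X) (\<rho> \<circ> id) id"
    using \<rho>X by (intro homotopic_with_equal continuous_map_compose[OF incl cont]) auto
  ultimately show ?thesis
    unfolding homotopy_equivalent_space_def using cont incl by blast
qed

lemma contractible_realization_collapsible:
  assumes "collapsible A" "A \<noteq> {}" "finite V" "\<Union>A \<subseteq> V"
  shows "contractible_space (realization V A) \<and> realization_points V A \<noteq> {}"
  using assms(1,2,4)
proof (induction A rule: collapsible.induct)
  case (expand X t x)
  let ?K = "insert t (insert (insert x t) X)"
  show ?case
  proof (cases "X = {}")
    case True
    have t: "t = {}"
    proof (rule ccontr)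
      assume "t \<noteq> {}"
      then have "{} \<in> X" using expand.hyps(5)[of "{}"] by blast
      with True show False by simp
    qed
    have x: "x \<in> V" using expand.prems by blast
    define p where "p = (\<lambda>v\<in>V. if v = x then 1 else (0::real))"
    have p: "p \<in> realization_points V ?K"
    proof (rule realization_pointsI)
      show "(\<Sum>v\<in>V. p v) = 1" using x assms(3) by (simp add: p_def)
      have "support V p = {x}" using x by (auto simp: support_def p_def)
      then show "support V p \<in> ?K" using t by simp
    qed (simp_all add: p_def)
    have "y = p" if y: "y \<in> realization_points V ?K" for y
    proof -
      have "support V y \<subseteq> {x}" using realization_pointsD(4)[OF y] t True by auto
      then have z: "y v = 0" if "v \<in> V" "v \<noteq> x" for v using that by (auto simp: support_def)
      have "(\<Sum>v\<in>V. y v) = y x + (\<Sum>v\<in>V - {x}. y v)" using assms(3) x by (simp add: sum.remove)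
      also have "(\<Sum>v\<in>V - {x}. y v) = 0" using z by (intro sum.neutral) auto
      finally have "y x = 1" using realization_pointsD(3)[OF y] by simp
      show ?thesis
      proof (rule extensionalityI[OF realization_pointsD(1)[OF y] realization_pointsD(1)[OF p]])
        show "y v = p v" if "v \<in> V" for v using z that \<open>y x = 1\<close> by (simp add: p_def)
      qed
    qed
    then have "topspace (realization V ?K) \<subseteq> {p}" unfolding topspace_realization by (intro subsetI) simp
    then have "contractible_space (realization V ?K)" by (rule contractible_space_subset_singleton)
    moreover have "realization_points V ?K \<noteq> {}" using p by (metis emptyE)
    ultimately show ?thesis by (rule conjI)
  next
    case False
    have t: "t \<noteq> {}"
      using False expand.hyps(1,4) collapsible_downward_closed by blast
    have eq: "realization V ?K homotopy_equivalent_space realization V X"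
    proof (rule elementary_expansion_homotopy_equivalent)
      show "insert x t \<subseteq> V" using expand.prems by blast
      show "r \<in> X" if "s \<in> X" "r \<subseteq> s" for s r
        by (rule collapsible_downward_closed[OF expand.hyps(1) that])
    qed (use assms(3) t expand.hyps in blast)+
    have "contractible_space (realization V X) \<and> realization_points V X \<noteq> {}"
      using expand.IH False expand.prems(2) by blast
    moreover have "realization_points V X \<subseteq> realization_points V ?K"
      by (rule realization_points_mono) blast
    ultimately show ?thesis unfolding homotopy_equivalent_space_contractibility[OF eq] by (metis subset_empty)
  qed
qed simp

section \<open>Collapsing a contractible subspace\<close>

text \<open>Let the deformation \<open>h\<close> of the identity preserve \<open>A\<close> and end with a map \<open>f\<close> that is constant on \<open>A\<close>.
  Then \<open>f\<close> factors through the quotient \<open>W\<close> as \<open>g \<circ> q\<close>, and \<open>g\<close> is a homotopy inverse of \<open>q\<close>: one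
  composite is deformed by \<open>h\<close> itself, the other one by the map that \<open>h\<close> induces on \<open>W\<close>.  Continuity of
  the induced map rests on the product of a quotient map with the compact Hausdorff unit interval
  being a quotient map again.\<close>

lemma quotient_of_deformable_subset_homotopy_equivalent:
  assumes q: "quotient_map X W q" and A: "A \<subseteq> topspace X"
    and fibres: "\<And>x y. x \<in> topspace X \<Longrightarrow> y \<in> topspace X \<Longrightarrow> q x = q y \<longleftrightarrow> x = y \<or> x \<in> A \<and> y \<in> A"
    and hom: "homotopic_with (\<lambda>k. k ` A \<subseteq> A) X X id f"
    and f: "\<And>x. x \<in> A \<Longrightarrow> f x = a"
  shows "X homotopy_equivalent_space W"
proof -
  let ?I = "top_of_set {0..1::real}"
  obtain h where h: "continuous_map (prod_topology ?I X) X h" "\<And>x. h (0, x) = x" "\<And>x. h (1, x) = f x"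
      and hA: "\<And>t x. t \<in> {0..1} \<Longrightarrow> x \<in> A \<Longrightarrow> h (t, x) \<in> A"
    using hom by (auto simp: homotopic_with_def image_subset_iff)
  have contf: "continuous_map X X f" using hom homotopic_with_imp_continuous_maps by blast
  \<comment> \<open>Different choices of preimages differ only within \<open>A\<close>, where \<open>f\<close> and \<open>q\<close> are constant.\<close>
  define sec where "sec w = (SOME x. x \<in> topspace X \<and> q x = w)" for w
  have sec: "sec (q x) \<in> topspace X \<and> q (sec (q x)) = q x" if "x \<in> topspace X" for x
    unfolding sec_def by (rule someI[of _ x]) (simp add: that)
  have sec_cases: "sec (q x) = x \<or> sec (q x) \<in> A \<and> x \<in> A" if "x \<in> topspace X" for x
    using fibres[of "sec (q x)" x] sec that by blast
  define g where "g w = f (sec w)" for w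
  have gq: "g (q x) = f x" if "x \<in> topspace X" for x
    using sec_cases[OF that] f unfolding g_def by metis
  have contq: "continuous_map X W q" using q by (rule quotient_imp_continuous_map)
  have contg: "continuous_map W X g"
  proof (rule continuous_compose_quotient_map[OF q])
    show "continuous_map X X (g \<circ> q)"
      using contf by (rule continuous_map_eq) (simp add: gq)
  qed
  have "homotopic_with (\<lambda>x. True) X X (g \<circ> q) f"
    using gq contf continuous_map_compose[OF contq contg] by (intro homotopic_with_equal) auto
  moreover have "homotopic_with (\<lambda>x. True) X X f id"
    by (rule homotopic_with_symD, rule homotopic_with_mono[OF hom]) simp
  ultimately have 1: "homotopic_with (\<lambda>x. True) X X (g \<circ> q) id"
    by (rule homotopic_with_trans)
  define H where "H = (\<lambda>(t::real, w). q (h (t, sec w)))"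
  have idq: "quotient_map (prod_topology ?I X) (prod_topology ?I W) (\<lambda>(t, x). (t, q x))"
  proof (rule quotient_map_prod_right[OF _ _ q])
    show "locally_compact_space ?I"
      by (intro compact_imp_locally_compact_space compact_space_subtopology) simp
    show "Hausdorff_space ?I \<or> regular_space ?I"
      by (simp add: Hausdorff_space_subtopology)
  qed
  have Hq: "H (t, q x) = q (h (t, x))" if "t \<in> {0..1}" "x \<in> topspace X" for t x
    using sec_cases[OF that(2)]
  proof
    assume "sec (q x) \<in> A \<and> x \<in> A"
    then have "h (t, sec (q x)) \<in> A" "h (t, x) \<in> A" using hA that by blast+
    then show ?thesis unfolding H_def using fibres A by auto
  qed (simp add: H_def)
  have contH: "continuous_map (prod_topology ?I W) W H"
  proof (rule continuous_compose_quotient_map[OF idq])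
    show "continuous_map (prod_topology ?I X) W (H \<circ> (\<lambda>(t, x). (t, q x)))"
      using continuous_map_compose[OF h(1) contq]
      by (rule continuous_map_eq) (auto simp: Hq)
  qed
  have surj: "q ` topspace X = topspace W" using q by (rule quotient_imp_surjective_map)
  have H0: "H (0, w) = w" and H1: "H (1, w) = q (g w)" if "w \<in> topspace W" for w
  proof -
    have "w \<in> q ` topspace X" unfolding surj by (rule that)
    then obtain x where x: "x \<in> topspace X" "w = q x" by (elim imageE)
    show "H (0, w) = w" "H (1, w) = q (g w)"
      using Hq[of 0 x] Hq[of 1 x] x h(2,3) gq[OF x(1)] by simp_all
  qed
  have "homotopic_with (\<lambda>x. True) W W id (q \<circ> g)"
    using contH H0 H1 by (subst homotopic_with) (simp_all add: exI[of _ H])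
  then have "homotopic_with (\<lambda>x. True) W W (q \<circ> g) id"
    by (rule homotopic_with_symD)
  with 1 contq contg show ?thesis unfolding homotopy_equivalent_space_def by blast
qed

text \<open>A space covered by a closed set \<open>A\<close> and finitely many closed cells \<open>C i\<close> maps onto the wedge of the
  \<open>Y i\<close> by sending \<open>A\<close> to the base point and each cell through its own quotient map.  Closedness of a
  preimage can be tested on the finitely many pieces, which is why the result is a quotient map.\<close>

lemma quotient_map_to_wedge:
  assumes I: "finite I" "I \<noteq> {}" and p: "\<And>i. i \<in> I \<Longrightarrow> p i \<in> topspace (Y i)"
    and A: "closedin X A" "A \<noteq> {}" and C: "\<And>i. i \<in> I \<Longrightarrow> closedin X (C i)"
    and cover: "topspace X = A \<union> (\<Union>i\<in>I. C i)"
    and \<phi>: "\<And>i. i \<in> I \<Longrightarrow> quotient_map (subtopology X (C i)) (Y i) (\<phi> i)"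
    and qA: "\<And>x. x \<in> A \<Longrightarrow> q x = None"
    and qC: "\<And>i x. i \<in> I \<Longrightarrow> x \<in> C i \<Longrightarrow> q x = wedge_map p (i, \<phi> i x)"
  shows "quotient_map X (wedge_topology Y p I) q"
proof -
  let ?W = "wedge_topology Y p I" and ?S = "sum_topology Y I"
  have Csub: "C i \<subseteq> topspace X" if "i \<in> I" for i using C[OF that] closedin_subset by blast
  have topW: "topspace ?W = wedge_map p ` Sigma I (topspace \<circ> Y)"
    using quotient_imp_surjective_map[OF quotient_map_wedge_topology[of Y I p]] by simp
  have im: "\<phi> i ` C i = topspace (Y i)" if "i \<in> I" for i
    using quotient_imp_surjective_map[OF \<phi>[OF that]] Csub[OF that] by (simp add: Int_absorb1)
  have qCi: "q ` C i = (\<lambda>y. wedge_map p (i, y)) ` topspace (Y i)" if "i \<in> I" for i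
    unfolding im[OF that, symmetric] image_image using qC[OF that] by (rule image_cong[OF refl])
  obtain i0 where i0: "i0 \<in> I" using I by blast
  have "wedge_map p (i0, p i0) = None" by (simp add: wedge_map_def)
  then have None: "None \<in> topspace ?W" unfolding topW using i0 p[OF i0]
    by (intro image_eqI[of _ _ "(i0, p i0)"]) auto
  have "q ` topspace X = q ` A \<union> (\<Union>i\<in>I. q ` C i)" unfolding cover by blast
  also have "q ` A = {None}" using qA A(2) by (simp add: image_constant_conv cong: image_cong)
  also have "(\<Union>i\<in>I. q ` C i) = (\<Union>i\<in>I. (\<lambda>y. wedge_map p (i, y)) ` topspace (Y i))"
    by (rule SUP_cong[OF refl qCi])
  also have "\<dots> = topspace ?W"
    unfolding topW by force
  finally have surj: "q ` topspace X = topspace ?W"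
    by (simp only: insert_is_Un[symmetric] insert_absorb[OF None])
  have "closedin X {x \<in> topspace X. q x \<in> U} \<longleftrightarrow> closedin ?W U" if U: "U \<subseteq> topspace ?W" for U
  proof -
    have "closedin ?W U \<longleftrightarrow> closedin ?S {z \<in> topspace ?S. wedge_map p z \<in> U}"
      using quotient_map_wedge_topology[of Y I p] U unfolding quotient_map_closedin by blast
    also have "\<dots> \<longleftrightarrow> (\<forall>i\<in>I. closedin (Y i) {y \<in> topspace (Y i). wedge_map p (i, y) \<in> U})"
      unfolding closedin_sum_topology by auto
    also have "\<dots> \<longleftrightarrow> (\<forall>i\<in>I. closedin (subtopology X (C i)) {x \<in> C i. q x \<in> U})"
    proof (rule ball_cong[OF refl])
      fix i assume i: "i \<in> I"
      let ?V = "{y \<in> topspace (Y i). wedge_map p (i, y) \<in> U}"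
      have eq: "{x \<in> topspace (subtopology X (C i)). \<phi> i x \<in> ?V} = {x \<in> C i. q x \<in> U}"
        using im[OF i] Csub[OF i] qC[OF i] by (auto simp: Int_absorb1)
      have "?V \<subseteq> topspace (Y i)" by blast
      with \<phi>[OF i, unfolded quotient_map_closedin] have
        "closedin (subtopology X (C i)) {x \<in> topspace (subtopology X (C i)). \<phi> i x \<in> ?V} \<longleftrightarrow>
           closedin (Y i) ?V"
        by (elim conjE allE[of _ ?V] impE)
      then show "closedin (Y i) ?V \<longleftrightarrow> closedin (subtopology X (C i)) {x \<in> C i. q x \<in> U}"
        unfolding eq by (rule sym)
    qed
    also have "\<dots> \<longleftrightarrow> (\<forall>i\<in>I. closedin X {x \<in> C i. q x \<in> U})"
      by (rule ball_cong[OF refl], subst closedin_closed_subtopology[OF C]) auto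
    also have "\<dots> \<longleftrightarrow> closedin X {x \<in> topspace X. q x \<in> U}"
    proof
      assume "\<forall>i\<in>I. closedin X {x \<in> C i. q x \<in> U}"
      then have "closedin X (\<Union>i\<in>I. {x \<in> C i. q x \<in> U})"
        using I(1) by (intro closedin_Union) auto
      moreover have "closedin X (if None \<in> U then A else {})" using A by simp
      ultimately have "closedin X ((\<Union>i\<in>I. {x \<in> C i. q x \<in> U}) \<union> (if None \<in> U then A else {}))"
        by (rule closedin_Un)
      also have "(\<Union>i\<in>I. {x \<in> C i. q x \<in> U}) \<union> (if None \<in> U then A else {}) = {x \<in> topspace X. q x \<in> U}"
        unfolding cover using qA by auto
      finally show "closedin X {x \<in> topspace X. q x \<in> U}" .
    next
      assume cl: "closedin X {x \<in> topspace X. q x \<in> U}"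
      show "\<forall>i\<in>I. closedin X {x \<in> C i. q x \<in> U}"
      proof
        fix i assume i: "i \<in> I"
        have "{x \<in> C i. q x \<in> U} = C i \<inter> {x \<in> topspace X. q x \<in> U}" using Csub[OF i] by blast
        then show "closedin X {x \<in> C i. q x \<in> U}" using cl C[OF i] by (simp add: closedin_Int)
      qed
    qed
    finally show ?thesis by blast
  qed
  then show ?thesis unfolding quotient_map_closedin using surj by blast
qed

text \<open>The homotopy extension property of the subcomplex \<open>A\<close> in \<open>K\<close>, made explicit.  On a facet \<open>s\<close> outside
  \<open>A\<close>, \<open>c\<close> runs from 0 on the boundary to 1 at the barycentre and is the weight of the barycentre when
  a point is written as a convex combination of the barycentre and a boundary point.  A first,
  straight-line homotopy from the identity to \<open>E\<close> stretches the half \<open>c \<ge> 1/2\<close> over the whole facet and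
  projects the collar \<open>c \<le> 1/2\<close> radially onto the boundary, hence into \<open>A\<close>.  The collar then provides
  the room in which a contraction of \<open>|A|\<close> is faded out.\<close>

lemma deformation_crushing_subcomplex:
  assumes V: "finite V" "\<Union>K \<subseteq> V" and K: "finite K" "A \<subseteq> K"
    and downK: "\<And>s r. s \<in> K \<Longrightarrow> r \<subseteq> s \<Longrightarrow> r \<in> K"
    and facets: "\<And>s t. s \<in> K - A \<Longrightarrow> t \<in> K \<Longrightarrow> s \<subseteq> t \<Longrightarrow> t = s"
    and ne: "{} \<notin> K - A"
    and contr: "contractible_space (realization V A)"
  obtains f a where
    "homotopic_with (\<lambda>k. k ` realization_points V A \<subseteq> realization_points V A)
       (realization V K) (realization V K) id f"
    "\<And>x. x \<in> realization_points V A \<Longrightarrow> f x = a"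
proof -
  let ?S = "K - A" and ?PK = "realization_points V K" and ?PA = "realization_points V A"
  let ?K = "realization V K" and ?A = "realization V A" and ?I = "top_of_set {0..1::real}"
  let ?P = "\<lambda>k. k ` ?PA \<subseteq> ?PA"
  have AK: "?PA \<subseteq> ?PK" by (rule realization_points_mono[OF K(2)])
  have finS: "finite ?S" using K(1) by simp
  have S: "s \<subseteq> V" "finite s" "s \<noteq> {}" if "s \<in> ?S" for s
  proof -
    show "s \<subseteq> V" using that V(2) by blast
    then show "finite s" using V(1) finite_subset by blast
    show "s \<noteq> {}" using that ne by metis
  qed
  \<comment> \<open>\<open>\<mu> s\<close> vanishes off the open cell of the facet \<open>s\<close>, so at most one summand of \<open>b\<close> and \<open>c\<close> is
    nonzero at any point: \<open>b x\<close> is \<open>c x\<close> times the barycentre of the facet containing \<open>x\<close>.\<close>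
  define \<mu> where "\<mu> s x = Min (x ` s)" for s and x :: "'a \<Rightarrow> real"
  define b where "b x v = (\<Sum>s\<in>?S. if v \<in> s then \<mu> s x else 0)" for x v
  define c where "c x = (\<Sum>s\<in>?S. card s * \<mu> s x)" for x
  have \<mu>_le: "\<mu> s x \<le> x v" if "s \<in> ?S" "v \<in> s" for s x v
    using that S(2)[OF that(1)] by (simp add: \<mu>_def)
  have \<mu>_att: "\<exists>v\<in>s. \<mu> s x = x v" if "s \<in> ?S" for s x
  proof -
    have "\<mu> s x \<in> x ` s" unfolding \<mu>_def using S[OF that] by (intro Min_in) auto
    then show ?thesis by blast
  qed
  have \<mu>0: "0 \<le> \<mu> s x" if "s \<in> ?S" "x \<in> ?PK" for s x
    using \<mu>_att[OF that(1), of x] realization_pointsD(2)[OF that(2)] S(1)[OF that(1)] by auto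
  have \<mu>_zero: "\<mu> s x = 0" if s: "s \<in> ?S" "s \<noteq> support V x" and x: "x \<in> ?PK" for s x
  proof -
    have "\<not> s \<subseteq> support V x"
      using facets[OF s(1) realization_pointsD(4)[OF x]] s(2) by metis
    then obtain v where "v \<in> s" "v \<notin> support V x" by blast
    then have "\<mu> s x \<le> 0" using \<mu>_le[OF s(1), of v x] S(1)[OF s(1)] by (auto simp: support_def)
    then show ?thesis using \<mu>0[OF s(1) x] by simp
  qed
  have on_A: "b x v = 0" "c x = 0" if x: "x \<in> ?PA" for x v
  proof -
    have z: "\<mu> s x = 0" if "s \<in> ?S" for s
    proof (rule \<mu>_zero[OF that])
      show "s \<noteq> support V x" using realization_pointsD(4)[OF x] that by auto
      show "x \<in> ?PK" using AK x by (rule subsetD)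
    qed
    show "b x v = 0" unfolding b_def by (intro sum.neutral ballI) (simp add: z)
    show "c x = 0" unfolding c_def by (intro sum.neutral ballI) (simp add: z)
  qed
  have off_A: "support V x \<in> ?S"
      "b x v = (if v \<in> support V x then \<mu> (support V x) x else 0)"
      "c x = card (support V x) * \<mu> (support V x) x"
    if x: "x \<in> ?PK" "x \<notin> ?PA" for x v
  proof -
    show s: "support V x \<in> ?S" using x by (auto simp: realization_points_def)
    have z: "\<mu> s x = 0" if "s \<in> ?S - {support V x}" for s
      using \<mu>_zero[OF _ _ x(1)] that by blast
    have "(\<Sum>s\<in>?S - {support V x}. if v \<in> s then \<mu> s x else 0) = 0"
      by (intro sum.neutral ballI) (simp add: z)
    then show "b x v = (if v \<in> support V x then \<mu> (support V x) x else 0)"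
      unfolding b_def sum.remove[OF finS s] by simp
    have "(\<Sum>s\<in>?S - {support V x}. card s * \<mu> s x) = 0"
      by (intro sum.neutral ballI) (simp add: z)
    then show "c x = card (support V x) * \<mu> (support V x) x"
      unfolding c_def sum.remove[OF finS s] by simp
  qed
  have b_bounds: "0 \<le> b x v" "b x v \<le> x v" if "x \<in> ?PK" "v \<in> V" for x v
  proof -
    have "0 \<le> b x v \<and> b x v \<le> x v"
    proof (cases "x \<in> ?PA")
      case True
      then show ?thesis using on_A(1) realization_pointsD(2)[OF that] by simp
    next
      case False
      note o = off_A[OF that(1) False]
      show ?thesis unfolding o(2)
        using \<mu>0[OF o(1) that(1)] \<mu>_le[OF o(1)] realization_pointsD(2)[OF that] by simp
    qed
    then show "0 \<le> b x v" "b x v \<le> x v" by simp_all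
  qed
  have b_sum: "(\<Sum>v\<in>V. b x v) = c x" if x: "x \<in> ?PK" for x
  proof (cases "x \<in> ?PA")
    case True
    then show ?thesis using on_A by simp
  next
    case False
    note o = off_A[OF x False]
    have "V \<inter> support V x = support V x" by (auto simp: support_def)
    then have "(\<Sum>v\<in>V. b x v) = (\<Sum>v\<in>support V x. \<mu> (support V x) x)"
      unfolding o(2) sum.inter_restrict[OF V(1), symmetric] by simp
    then show ?thesis using o(3) by simp
  qed
  have c0: "0 \<le> c x" if x: "x \<in> ?PK" for x
    unfolding b_sum[OF x, symmetric] using b_bounds(1)[OF x] by (intro sum_nonneg)
  \<comment> \<open>On the collar only the first summand survives and it rescales \<open>x - b x\<close> to total mass 1.  On the
    inner half the point is stretched away from the barycentre by the factor 2.  The maxima keep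
    the denominators away from zero, which makes the formula continuous everywhere.\<close>
  define E where "E x = (\<lambda>v\<in>V. (x v - b x v) / max (1 - c x) (1/2)
      + max 0 (2 * c x - 1) / max (c x) (1/2) * b x v)" for x
  have E_A: "E x = x" if x: "x \<in> ?PA" for x
    using on_A[OF x] realization_pointsD(1)[OF x] by (auto simp: E_def extensional_def)
  have E_supp: "support V (E x) \<subseteq> support V x" if x: "x \<in> ?PK" for x
  proof
    fix v assume v: "v \<in> support V (E x)"
    then have vV: "v \<in> V" by (simp add: support_def)
    have "x v \<noteq> 0"
    proof
      assume "x v = 0"
      then have "b x v = 0" using b_bounds[OF x vV] by simp
      then show False using v vV \<open>x v = 0\<close> by (simp add: support_def E_def)
    qed
    then show "v \<in> support V x" using vV by (simp add: support_def)
  qed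
  have E_K: "E x \<in> ?PK" if x: "x \<in> ?PK" for x
  proof (rule realization_pointsI)
    show "E x \<in> extensional V" by (simp add: E_def)
    show "0 \<le> E x v" if v: "v \<in> V" for v
      using b_bounds[OF x v] v by (simp add: E_def)
    have "(\<Sum>v\<in>V. E x v) = ((\<Sum>v\<in>V. x v) - (\<Sum>v\<in>V. b x v)) / max (1 - c x) (1/2)
        + max 0 (2 * c x - 1) / max (c x) (1/2) * (\<Sum>v\<in>V. b x v)"
      by (simp add: E_def sum.distrib sum_subtractf sum_distrib_left sum_divide_distrib diff_divide_distrib)
    also have "\<dots> = (1 - c x) / max (1 - c x) (1/2) + max 0 (2 * c x - 1) / max (c x) (1/2) * c x"
      using b_sum[OF x] realization_pointsD(3)[OF x] by simp
    also have "\<dots> = 1"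
    proof (cases "c x \<le> 1/2")
      case True
      then have "max (1 - c x) (1/2) = 1 - c x" "max 0 (2 * c x - 1) = 0" by linarith+
      then show ?thesis using True by simp
    next
      case False
      then have "max (1 - c x) (1/2) = 1/2" "max 0 (2 * c x - 1) = 2 * c x - 1" "max (c x) (1/2) = c x"
        by linarith+
      then show ?thesis using False by simp
    qed
    finally show "(\<Sum>v\<in>V. E x v) = 1" .
    show "support V (E x) \<in> K" using downK[OF realization_pointsD(4)[OF x] E_supp[OF x]] .
  qed
  have E_collar: "E x \<in> ?PA" if x: "x \<in> ?PK" and cx: "c x \<le> 1/2" for x
  proof (cases "x \<in> ?PA")
    case True
    then show ?thesis using E_A by simp
  next
    case False
    note o = off_A[OF x False]
    obtain v where v: "v \<in> support V x" "\<mu> (support V x) x = x v" using \<mu>_att[OF o(1)] by blast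
    then have vV: "v \<in> V" by (simp add: support_def)
    have "max 0 (2 * c x - 1) = 0" using cx by simp
    then have "E x v = 0" using o(2)[of v] v vV by (simp add: E_def)
    then have "support V (E x) \<noteq> support V x" using v(1) by (auto simp: support_def)
    then have "support V (E x) \<notin> ?S"
      using facets[OF _ realization_pointsD(4)[OF x] E_supp[OF x]] by metis
    then show ?thesis using E_K[OF x] by (simp add: realization_points_def)
  qed
  have cont_\<mu>: "continuous_map ?K euclideanreal (\<mu> s)" if "s \<in> ?S" for s
    unfolding \<mu>_def[abs_def] using S[OF that]
    by (intro continuous_map_Min continuous_map_realization_component) auto
  have cont_c: "continuous_map ?K euclideanreal c"
    unfolding c_def[abs_def] using finS
    by (intro continuous_map_sum continuous_map_real_mult_left cont_\<mu>) auto
  have cont_b: "continuous_map ?K euclideanreal (\<lambda>x. b x v)" for v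
  proof -
    have "continuous_map ?K euclideanreal (\<lambda>x. if v \<in> s then \<mu> s x else 0)" if "s \<in> ?S" for s
      using cont_\<mu>[OF that] by simp
    then show ?thesis unfolding b_def using finS by (intro continuous_map_sum)
  qed
  have cont_E: "continuous_map ?K ?K E"
  proof (rule continuous_map_into_realization)
    fix v assume v: "v \<in> V"
    have "continuous_map ?K euclideanreal (\<lambda>x. (x v - b x v) / max (1 - c x) (1/2)
      + max 0 (2 * c x - 1) / max (c x) (1/2) * b x v)"
      by (intro continuous_map_add continuous_map_real_mult continuous_map_real_divide
          continuous_map_diff continuous_map_real_max continuous_map_real_mult_left cont_b cont_c
          continuous_map_realization_component v continuous_map_canonical_const) simp_all
    then show "continuous_map ?K euclideanreal (\<lambda>x. E x v)" using v by (simp add: E_def)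
  qed (use E_K in simp)
  have first: "homotopic_with ?P ?K ?K id E"
  proof (rule straight_line_homotopy)
    show "continuous_map ?K ?K id" by (rule continuous_map_id)
    show "continuous_map ?K ?K E" by (rule cont_E)
    show "\<exists>s\<in>K. support V (id x) \<subseteq> s \<and> support V (E x) \<subseteq> s" if "x \<in> topspace ?K" for x
      using that E_supp realization_pointsD(4) by (intro bexI[of _ "support V x"]) auto
    show "r \<in> K" if "s \<in> K" "r \<subseteq> s" for s r using downK[OF that] .
    show "?P h \<longleftrightarrow> ?P k" if "\<And>x. x \<in> topspace ?K \<Longrightarrow> h x = k x" for h k
    proof -
      have "h ` ?PA = k ` ?PA" using that AK by (intro image_cong) auto
      then show ?thesis by simp
    qed
    show "?P (\<lambda>x. segment V (id x) (E x) t)" if "t \<in> {0..1}" for t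
    proof (rule image_subsetI)
      fix x assume x: "x \<in> ?PA"
      show "segment V (id x) (E x) t \<in> ?PA"
        using x segment_same[OF realization_pointsD(1)[OF x], of t] by (simp add: E_A[OF x])
    qed
  qed
  obtain a where "homotopic_with (\<lambda>_. True) ?A ?A id (\<lambda>x. a)"
    using contr unfolding contractible_space_def by blast
  then obtain h where h: "continuous_map (prod_topology ?I ?A) ?A h"
      "\<And>x. h (0, x) = x" "\<And>x. h (1, x) = a"
    unfolding homotopic_with_def by auto
  have hA: "h (t, x) \<in> ?PA" if "t \<in> {0..1}" "x \<in> ?PA" for t x
    using continuous_map_image_subset_topspace[OF h(1)] that by (auto simp: image_subset_iff Pi_iff)
  \<comment> \<open>The contraction runs at full speed on \<open>A\<close>, where \<open>c = 0\<close>, and does not move at \<open>c = 1/2\<close>.\<close>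
  define G where "G p = (if c (snd p) \<le> 1/2
      then h (fst p * (1 - 2 * c (snd p)), E (snd p)) else E (snd p))" for p
  have contG: "continuous_map (prod_topology ?I ?K) ?K G"
  proof -
    let ?X = "prod_topology ?I ?K"
    let ?Y = "subtopology ?X {p \<in> topspace ?X. c (snd p) \<le> 1/2}"
    have c_snd: "continuous_map ?X euclideanreal (\<lambda>p. c (snd p))"
      using continuous_map_compose[OF continuous_map_snd cont_c] by (simp add: o_def)
    have E_snd: "continuous_map ?X ?K (\<lambda>p. E (snd p))"
      using continuous_map_compose[OF continuous_map_snd cont_E] by (simp add: o_def)
    have fst: "continuous_map ?X euclideanreal fst"
      by (rule continuous_map_into_fulltopology[OF continuous_map_fst])
    have topY: "fst p \<in> {0..1} \<and> snd p \<in> ?PK \<and> c (snd p) \<le> 1/2" if "p \<in> topspace ?Y" for p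
      using that by auto
    have "continuous_map ?Y ?I (\<lambda>p. fst p * (1 - 2 * c (snd p)))"
      unfolding continuous_map_in_subtopology
    proof
      show "continuous_map ?Y euclidean (\<lambda>p. fst p * (1 - 2 * c (snd p)))"
        by (intro continuous_map_from_subtopology continuous_map_real_mult continuous_map_diff
            continuous_map_canonical_const fst c_snd)
      show "(\<lambda>p. fst p * (1 - 2 * c (snd p))) \<in> topspace ?Y \<rightarrow> {0..1}"
      proof
        fix p assume "p \<in> topspace ?Y"
        from topY[OF this] c0[of "snd p"] show "fst p * (1 - 2 * c (snd p)) \<in> {0..1}"
          by (simp add: mult_le_one)
      qed
    qed
    moreover have "continuous_map ?Y ?A (\<lambda>p. E (snd p))"
      unfolding subtopology_realization[OF K(2), symmetric] continuous_map_in_subtopology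
      using E_collar topY by (auto intro!: continuous_map_from_subtopology[OF E_snd])
    ultimately have "continuous_map ?Y (prod_topology ?I ?A) (\<lambda>p. (fst p * (1 - 2 * c (snd p)), E (snd p)))"
      by (simp add: continuous_map_pairwise o_def)
    from continuous_map_compose[OF this h(1)]
    have "continuous_map ?Y ?A (\<lambda>p. h (fst p * (1 - 2 * c (snd p)), E (snd p)))"
      by (simp add: o_def)
    then have "continuous_map ?Y ?K (\<lambda>p. h (fst p * (1 - 2 * c (snd p)), E (snd p)))"
      unfolding subtopology_realization[OF K(2), symmetric] by (rule continuous_map_into_fulltopology)
    then have "continuous_map ?X ?K (\<lambda>p. if c (snd p) \<le> 1/2
        then h (fst p * (1 - 2 * c (snd p)), E (snd p)) else E (snd p))"
    proof (rule continuous_map_cases_le[OF c_snd continuous_map_canonical_const])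
      show "continuous_map (subtopology ?X {p \<in> topspace ?X. 1/2 \<le> c (snd p)}) ?K (\<lambda>p. E (snd p))"
        by (rule continuous_map_from_subtopology[OF E_snd])
      show "h (fst p * (1 - 2 * c (snd p)), E (snd p)) = E (snd p)" if "c (snd p) = 1/2" for p
        unfolding that by (simp add: h(2))
    qed
    then show ?thesis unfolding G_def[abs_def] .
  qed
  have G0: "G (0, x) = E x" for x by (simp add: G_def h(2))
  have GA: "G (t, x) = h (t, x)" if "x \<in> ?PA" for t x
    using on_A(2)[OF that] E_A[OF that] by (simp add: G_def)
  have second: "homotopic_with ?P ?K ?K E (\<lambda>x. G (1, x))"
    unfolding homotopic_with_def
  proof (intro exI[of _ G] conjI allI ballI)
    show "?P (\<lambda>x. G (t, x))" if "t \<in> {0..1}" for t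
      using GA hA[OF that] by auto
  qed (simp_all add: contG G0)
  show thesis
  proof (rule that)
    show "homotopic_with ?P ?K ?K id (\<lambda>x. G (1, x))"
      by (rule homotopic_with_trans[OF first second])
    show "G (1, x) = a" if "x \<in> ?PA" for x using GA[OF that] h(3) by simp
  qed
qed

section \<open>A simplex modulo its boundary\<close>

lemma compact_space_closed_simplex:
  assumes "finite V" shows "compact_space (subtopology (powertop_real V) (closed_simplex V s))"
proof -
  have "x v \<le> 1" if "x \<in> closed_simplex V s" "v \<in> V" for x v
    using that member_le_sum[of v V x] assms by (auto simp: closed_simplex_def)
  then have "closed_simplex V s \<subseteq> (\<Pi>\<^sub>E v\<in>V. {0..1})"
    by (auto simp: closed_simplex_def PiE_def)
  moreover have "compactin (powertop_real V) (\<Pi>\<^sub>E v\<in>V. {0..1})"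
    by (subst compactin_PiE) simp
  ultimately have "compactin (powertop_real V) (closed_simplex V s)"
    using closed_compactin closedin_closed_simplex[OF assms] by blast
  then show ?thesis by (rule compact_space_subtopology)
qed

text \<open>The quotient map is stereographic projection in homogeneous coordinates.  With \<open>z\<close> the
  displacement from the barycentre in the coordinates \<open>1, \<dots>, d\<close> and \<open>m\<close> the rescaled smallest coordinate (1 at the barycentre, 0 on
  the boundary), \<open>x \<mapsto> z / m\<close> maps the open simplex bijectively to \<open>d\<close>-dimensional space, and inverse
  stereographic projection takes \<open>w\<close> to \<open>((|w|\<^sup>2 - 1) / (|w|\<^sup>2 + 1), 2w / (|w|\<^sup>2 + 1))\<close>.  Clearing
  denominators yields \<open>\<phi>\<close>, which is defined on the boundary as well and sends it to the base point.\<close>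

lemma simplex_boundary_quotient_sphere:
  fixes V :: "'v set"
  assumes V: "finite V" "s \<subseteq> V" and card: "card s = Suc d" and d: "0 < d"
  obtains \<phi> where
    "quotient_map (subtopology (powertop_real V) (closed_simplex V s)) (nsphere d) \<phi>"
    "\<And>x. x \<in> closed_simplex V s \<Longrightarrow> \<phi> x = nsphere_base \<longleftrightarrow> (\<exists>v\<in>s. x v = 0)"
    "\<And>x y. x \<in> closed_simplex V s \<Longrightarrow> y \<in> closed_simplex V s \<Longrightarrow>
        \<forall>v\<in>s. x v \<noteq> 0 \<Longrightarrow> \<forall>v\<in>s. y v \<noteq> 0 \<Longrightarrow> \<phi> x = \<phi> y \<Longrightarrow> x = y"
proof -
  let ?C = "closed_simplex V s" and ?X = "subtopology (powertop_real V) (closed_simplex V s)"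
  have fins: "finite s" and s_ne: "s \<noteq> {}" using V finite_subset card by auto
  obtain e where e: "bij_betw e {..d} s"
    using ex_bij_betw_nat_finite[OF fins] card by (auto simp: atLeast0LessThan lessThan_Suc_atMost)
  have e_in: "e i \<in> s" if "i \<le> d" for i using e that by (auto simp: bij_betw_def)
  have e_surj: "\<exists>i\<le>d. v = e i" if "v \<in> s" for v using e that by (force simp: bij_betw_def)
  define n where "n = real (Suc d)"
  have n: "n > 0" by (simp add: n_def)
  define z where "z x i = x (e i) - 1 / n" for x i
  define m where "m x = n * Min (x ` s)" for x :: "'v \<Rightarrow> real"
  define Q where "Q x = (\<Sum>i=1..d. (z x i)\<^sup>2)" for x
  define D where "D x = Q x + (m x)\<^sup>2" for x
  define \<phi> where "\<phi> x = (\<lambda>i. if i = 0 then (Q x - (m x)\<^sup>2) / D x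
       else if i \<le> d then 2 * m x * z x i / D x else 0)" for x
  have split0: "(\<Sum>i\<le>d. f i) = f 0 + (\<Sum>i=1..d. f i)" for f :: "nat \<Rightarrow> real"
    by (simp add: sum.atMost_shift sum.atLeast1_atMost_eq lessThan_atLeast0)
  have C: "x \<in> extensional V" "v \<in> V \<Longrightarrow> 0 \<le> x v" "(\<Sum>v\<in>V. x v) = 1" "v \<in> V - s \<Longrightarrow> x v = 0"
    if "x \<in> ?C" for x v using that by (auto simp: closed_simplex_def)
  have sum_s: "(\<Sum>v\<in>s. f v) = (\<Sum>i\<le>d. f (e i))" for f :: "'v \<Rightarrow> real"
    using sum.reindex_bij_betw[OF e, of f] by simp
  have sum1: "(\<Sum>i\<le>d. x (e i)) = 1" if "x \<in> ?C" for x
  proof -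
    have "(\<Sum>v\<in>s. x v) = (\<Sum>v\<in>V. x v)"
      using V C(4)[OF that] by (intro sum.mono_neutral_left) auto
    then show ?thesis using C(3)[OF that] by (simp add: sum_s)
  qed
  have one: "(\<Sum>i\<le>d. 1 / n) = 1" by (simp add: n_def)
  have zsum: "(\<Sum>i\<le>d. z x i) = 0" if "x \<in> ?C" for x
    unfolding z_def sum_subtractf one sum1[OF that] by simp
  have mle: "m x \<le> n * x v" if "v \<in> s" for x v
    using that fins n by (simp add: m_def)
  have matt: "\<exists>v\<in>s. m x = n * x v" for x
  proof -
    have "Min (x ` s) \<in> x ` s" using fins s_ne by (intro Min_in) auto
    then show ?thesis by (auto simp: m_def)
  qed
  have m0: "0 \<le> m x" if "x \<in> ?C" for x
    using matt[of x] C(2)[OF that] V(2) n by auto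
  have m0_iff: "m x = 0 \<longleftrightarrow> (\<exists>v\<in>s. x v = 0)" if "x \<in> ?C" for x
  proof
    assume "m x = 0" then show "\<exists>v\<in>s. x v = 0" using matt[of x] n by auto
  next
    assume "\<exists>v\<in>s. x v = 0" then show "m x = 0" using mle[of _ x] m0[OF that] by force
  qed
  have Q0: "0 \<le> Q x" for x by (simp add: Q_def sum_nonneg)
  have Dpos: "D x > 0" if x: "x \<in> ?C" for x
  proof (rule ccontr)
    assume "\<not> D x > 0"
    then have "Q x + (m x)\<^sup>2 \<le> 0" by (simp add: D_def)
    then have Q: "Q x = 0" and "(m x)\<^sup>2 = 0" using Q0[of x] zero_le_power2[of "m x"] by linarith+
    then have m: "m x = 0" by simp
    have zi: "z x i = 0" if "i \<in> {1..d}" for i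
      using Q that unfolding Q_def by (subst (asm) sum_nonneg_eq_0_iff) auto
    then have "z x 0 = 0" using zsum[OF x] by (simp add: split0)
    with zi have "z x i = 0" if "i \<le> d" for i using that by (cases "i = 0") auto
    moreover obtain v where v: "v \<in> s" "x v = 0" using m m0_iff[OF x] by blast
    moreover obtain i where "i \<le> d" "v = e i" using e_surj[OF v(1)] by blast
    ultimately show False using n by (auto simp: z_def)
  qed
  have sphere: "\<phi> x \<in> topspace (nsphere d)" if x: "x \<in> ?C" for x
  proof -
    have "(\<Sum>i=1..d. (\<phi> x i)\<^sup>2) = (\<Sum>i=1..d. (2 * m x / D x)\<^sup>2 * (z x i)\<^sup>2)"
      by (rule sum.cong) (auto simp: \<phi>_def power_mult_distrib power_divide)
    also have "\<dots> = (2 * m x / D x)\<^sup>2 * Q x" by (simp add: Q_def sum_distrib_left)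
    finally have "(\<Sum>i\<le>d. (\<phi> x i)\<^sup>2) = ((Q x - (m x)\<^sup>2)\<^sup>2 + 4 * (m x)\<^sup>2 * Q x) / (D x)\<^sup>2"
      unfolding split0 by (simp add: \<phi>_def power_mult_distrib power_divide add_divide_distrib)
    also have "(Q x - (m x)\<^sup>2)\<^sup>2 + 4 * (m x)\<^sup>2 * Q x = (D x)\<^sup>2"
      by (simp add: D_def power2_eq_square algebra_simps)
    finally have "(\<Sum>i\<le>d. (\<phi> x i)\<^sup>2) = 1" using Dpos[OF x] by simp
    moreover have "\<forall>i>d. \<phi> x i = 0" by (simp add: \<phi>_def)
    ultimately show ?thesis by (simp add: nsphere)
  qed
  have topX: "topspace ?X = ?C"
    using closedin_subset[OF closedin_closed_simplex[OF V(1)]] by (simp add: Int_absorb1)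
  have cont_z: "continuous_map ?X euclideanreal (\<lambda>x. z x i)" if "i \<le> d" for i
    unfolding z_def using e_in[OF that] V(2)
    by (intro continuous_map_diff continuous_map_powertop_component) auto
  have cont_m: "continuous_map ?X euclideanreal m"
    unfolding m_def[abs_def] using V(2) fins s_ne
    by (intro continuous_map_real_mult_left continuous_map_Min continuous_map_powertop_component) auto
  have cont_Q: "continuous_map ?X euclideanreal Q"
    unfolding Q_def[abs_def] by (intro continuous_map_sum continuous_map_real_pow cont_z) auto
  have cont_D: "continuous_map ?X euclideanreal D"
    unfolding D_def[abs_def] by (intro continuous_map_add continuous_map_real_pow cont_Q cont_m)
  have cont: "continuous_map ?X (nsphere d) \<phi>"
    unfolding nsphere continuous_map_in_subtopology continuous_map_componentwise_UNIV
  proof (intro conjI allI)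
    fix i
    have D: "D x \<noteq> 0" if "x \<in> topspace ?X" for x using Dpos that unfolding topX by force
    consider "i = 0" | "0 < i" "i \<le> d" | "i > d" by linarith
    then show "continuous_map ?X euclideanreal (\<lambda>x. \<phi> x i)"
    proof cases
      case 1
      have "continuous_map ?X euclideanreal (\<lambda>x. (Q x - (m x)\<^sup>2) / D x)"
        by (intro continuous_map_real_divide continuous_map_diff continuous_map_real_pow
            cont_Q cont_m cont_D D)
      then show ?thesis by (simp add: \<phi>_def 1)
    next
      case 2
      have "continuous_map ?X euclideanreal (\<lambda>x. 2 * m x * z x i / D x)"
        by (intro continuous_map_real_divide continuous_map_real_mult continuous_map_const[THEN iffD2]
            cont_m cont_D cont_z 2 D) simp
      then show ?thesis using 2 by (simp add: \<phi>_def)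
    next
      case 3
      then show ?thesis by (simp add: \<phi>_def)
    qed
  next
    show "\<phi> \<in> topspace ?X \<rightarrow> {x. (\<Sum>i\<le>d. (x i)\<^sup>2) = 1 \<and> (\<forall>i>d. x i = 0)}"
      unfolding topX using sphere by (simp add: nsphere)
  qed
  have one_minus: "1 - \<phi> x 0 = 2 * (m x)\<^sup>2 / D x" if "x \<in> ?C" for x
    using Dpos[OF that] by (simp add: \<phi>_def D_def field_simps)
  have base: "\<phi> x = nsphere_base \<longleftrightarrow> (\<exists>v\<in>s. x v = 0)" if x: "x \<in> ?C" for x
  proof -
    have "\<phi> x = nsphere_base \<longleftrightarrow> m x = 0"
    proof
      assume "\<phi> x = nsphere_base"
      then have "1 - \<phi> x 0 = 0" by (simp add: nsphere_base_def)
      then show "m x = 0" using one_minus[OF x] Dpos[OF x] by simp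
    next
      assume "m x = 0"
      then show "\<phi> x = nsphere_base"
        using Dpos[OF x] by (auto simp: \<phi>_def nsphere_base_def D_def)
    qed
    then show ?thesis using m0_iff[OF x] by simp
  qed
  have ratio: "z x i / m x = \<phi> x i / (1 - \<phi> x 0)" if "x \<in> ?C" "m x \<noteq> 0" "0 < i" "i \<le> d" for x i
    unfolding one_minus[OF that(1)] using that Dpos[OF that(1)]
    by (simp add: \<phi>_def power2_eq_square)
  have ratio0: "z x 0 = - (\<Sum>i=1..d. z x i)" if "x \<in> ?C" for x
    using zsum[OF that] by (simp add: split0)
  have inj: "x = y" if x: "x \<in> ?C" and y: "y \<in> ?C" and xy: "\<forall>v\<in>s. x v \<noteq> 0" "\<forall>v\<in>s. y v \<noteq> 0"
    and eq: "\<phi> x = \<phi> y" for x y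
  proof -
    have mx: "m x > 0" and my: "m y > 0"
      using m0[OF x] m0[OF y] m0_iff[OF x] m0_iff[OF y] xy by force+
    \<comment> \<open>Equal images make the displacements proportional; evaluating at the vertices where the two
      minima are attained forces the factor \<open>l\<close> to be 1.\<close>
    define l where "l = m x / m y"
    have l: "l > 0" "m x = l * m y" using mx my by (simp_all add: l_def)
    have "z x i = l * z y i" if "i \<in> {1..d}" for i
    proof -
      have "z x i / m x = z y i / m y"
        using ratio[of x i] ratio[of y i] that x y mx my eq by simp
      then show ?thesis using mx my by (simp add: l_def field_simps)
    qed
    then have "z x 0 = l * z y 0" unfolding ratio0[OF x] ratio0[OF y]
      by (simp add: sum_distrib_left)
    then have zl: "z x i = l * z y i" if "i \<le> d" for i
      using \<open>\<And>i. i \<in> {1..d} \<Longrightarrow> z x i = l * z y i\<close> that by (cases "i = 0") auto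
    have xl: "n * x v - 1 = l * (n * y v - 1)" if v: "v \<in> s" for v
    proof -
      obtain i where i: "i \<le> d" "v = e i" using e_surj[OF v] by blast
      have "n * z x i = l * (n * z y i)" using zl[OF i(1)] by simp
      then show ?thesis using n by (simp add: z_def i right_diff_distrib)
    qed
    have "l = 1"
    proof -
      obtain v where v: "v \<in> s" "m x = n * x v" using matt by blast
      have "l * (m y - 1) \<le> l * (n * y v - 1)" using mle[OF v(1), of y] l by simp
      then have "l * (m y - 1) \<le> m x - 1" using xl[OF v(1)] v(2) by simp
      then have "l \<ge> 1" using l by (simp add: algebra_simps)
      moreover obtain w where w: "w \<in> s" "m y = n * y w" using matt by blast
      have "m x - 1 \<le> l * (m y - 1)" using mle[OF w(1), of x] xl[OF w(1)] w(2) by simp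
      then have "l \<le> 1" using l by (simp add: algebra_simps)
      ultimately show ?thesis by simp
    qed
    have "x v = y v" if "v \<in> V" for v
    proof (cases "v \<in> s")
      case True
      then show ?thesis using xl[OF True] \<open>l = 1\<close> n by simp
    next
      case False
      then show ?thesis using C(4)[OF x] C(4)[OF y] that by simp
    qed
    then show "x = y" using extensionalityI[OF C(1)[OF x] C(1)[OF y]] by blast
  qed
  have surj: "\<phi> ` ?C = topspace (nsphere d)"
  proof
    show "\<phi> ` ?C \<subseteq> topspace (nsphere d)" using sphere by blast
    show "topspace (nsphere d) \<subseteq> \<phi> ` ?C"
    proof
      fix p assume "p \<in> topspace (nsphere d)"
      then have p1: "(\<Sum>i\<le>d. (p i)\<^sup>2) = 1" and p0: "\<And>i. i > d \<Longrightarrow> p i = 0"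
        by (simp_all add: nsphere)
      define c where "c u = (\<lambda>v\<in>V. if v \<in> s then u (the_inv_into {..d} e v) else 0)" for u :: "nat \<Rightarrow> real"
      have c: "c u (e i) = u i" if "i \<le> d" for u i
        using that e e_in[OF that] V(2) by (auto simp: c_def bij_betw_def the_inv_into_f_f)
      have cC: "c u \<in> ?C" if u: "\<And>i. i \<le> d \<Longrightarrow> 0 \<le> u i" "(\<Sum>i\<le>d. u i) = 1" for u
      proof -
        have "0 \<le> c u v" if "v \<in> V" for v
        proof (cases "v \<in> s")
          case True
          then obtain i where "i \<le> d" "v = e i" using e_surj by blast
          then show ?thesis using c u by simp
        qed (use that in \<open>simp add: c_def\<close>)
        moreover have "(\<Sum>v\<in>V. c u v) = (\<Sum>v\<in>s. c u v)"
          using V by (intro sum.mono_neutral_right) (auto simp: c_def)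
        then have "(\<Sum>v\<in>V. c u v) = 1" using u(2) c by (simp add: sum_s)
        ultimately show ?thesis by (auto simp: closed_simplex_def c_def)
      qed
      show "p \<in> \<phi> ` ?C"
      proof (cases "p 0 = 1")
        case True
        then have "(\<Sum>i=1..d. (p i)\<^sup>2) = 0" using p1 by (simp add: split0)
        then have "p i = 0" if "i \<in> {1..d}" for i
          using that by (subst (asm) sum_nonneg_eq_0_iff) auto
        with p0 have "p i = 0" if "i > 0" for i using that by (cases "i \<le> d") auto
        with True have p: "p = nsphere_base" by (auto simp: nsphere_base_def)
        define u where "u i = (if i = 0 then 1 else 0::real)" for i :: nat
        have "c u \<in> ?C" by (rule cC) (simp_all add: u_def)
        moreover have "c u (e 1) = 0" "e 1 \<in> s" using c[of 1 u] d e_in[of 1] by (auto simp: u_def)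
        ultimately have "\<phi> (c u) = nsphere_base" using base by blast
        then show ?thesis using \<open>c u \<in> ?C\<close> p by (intro image_eqI[of _ _ "c u"]) simp_all
      next
        case False
        have "(p 0)\<^sup>2 \<le> 1" using p1 sum_nonneg[of "{1..d}" "\<lambda>i. (p i)\<^sup>2"] by (simp add: split0)
        then have "p 0 \<le> 1" by (simp add: power2_le_iff_abs_le abs_square_le_1)
        then have p01: "p 0 < 1" using False by simp
        \<comment> \<open>\<open>w\<close> is the stereographic image of \<open>p\<close>, extended to the coordinate 0 so that its sum is 0.
          The preimage is \<open>1/n + t * w\<close>, and the scale \<open>t\<close> is determined by \<open>t = m\<close>, that is,
          by \<open>t = 1 - n * t * M\<close>.\<close>
        define w where "w i = (if i = 0 then - (\<Sum>i=1..d. p i / (1 - p 0)) else p i / (1 - p 0))" for i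
        have wsum: "(\<Sum>i\<le>d. w i) = 0" by (simp add: split0 w_def)
        define M where "M = - Min (w ` {..d})"
        have wM: "w i \<ge> - M" if "i \<le> d" for i
          using that Min_le[of "w ` {..d}" "w i"] unfolding M_def minus_minus by blast
        have "Min (w ` {..d}) \<in> w ` {..d}" by (intro Min_in) auto
        then have "- M \<in> w ` {..d}" unfolding M_def minus_minus .
        then obtain j where j: "j \<le> d" "w j = - M" by auto
        have M0: "M \<ge> 0"
        proof (rule ccontr)
          assume "\<not> M \<ge> 0"
          then have "w i > 0" if "i \<le> d" for i using wM[OF that] by linarith
          then have "(\<Sum>i\<le>d. w i) > 0" by (intro sum_pos) auto
          then show False using wsum by simp
        qed
        define t where "t = 1 / (1 + n * M)"
        have "1 + n * M > 0" using n M0 by (simp add: add_pos_nonneg)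
        then have t: "t > 0" "t * (1 + n * M) = 1" by (simp_all add: t_def)
        define u where "u i = 1 / n + t * w i" for i
        have u_ge: "u i \<ge> t / n" if "i \<le> d" for i
        proof -
          have "t * w i \<ge> - (t * M)" using wM[OF that] t(1) by (metis mult_left_mono less_imp_le mult_minus_right)
          moreover have "1 / n - t * M = t / n" using t(2) n by (simp add: field_simps)
          ultimately show ?thesis unfolding u_def by linarith
        qed
        have uj: "u j = t / n" using t(2) n j by (simp add: u_def field_simps)
        have "(\<Sum>i\<le>d. u i) = 1"
          unfolding u_def sum.distrib sum_distrib_left[symmetric] wsum one by simp
        moreover have "0 \<le> u i" if "i \<le> d" for i using u_ge[OF that] t(1) n by (smt (verit) divide_pos_pos)
        ultimately have x: "c u \<in> ?C" using cC by blast
        let ?x = "c u"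
        have zx: "z ?x i = t * w i" if "i \<le> d" for i using c[OF that] by (simp add: z_def u_def)
        have mx: "m ?x = t"
        proof (rule order_antisym)
          have "m ?x \<le> n * u j" using mle[OF e_in[OF j(1)], of ?x] c[OF j(1)] by simp
          then show "m ?x \<le> t" using uj n by simp
          obtain v where v: "v \<in> s" "m ?x = n * ?x v" using matt by blast
          obtain i where i: "i \<le> d" "v = e i" using e_surj[OF v(1)] by blast
          have "m ?x = n * u i" using v i c by simp
          then show "t \<le> m ?x" using u_ge[OF i(1)] n by (simp add: field_simps)
        qed
        define T where "T = (\<Sum>i=1..d. (w i)\<^sup>2)"
        have "T = (\<Sum>i=1..d. (p i)\<^sup>2 / (1 - p 0)\<^sup>2)"
          unfolding T_def by (rule sum.cong) (auto simp: w_def power_divide)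
        also have "\<dots> = (1 - (p 0)\<^sup>2) / (1 - p 0)\<^sup>2"
          using p1 by (simp add: split0 sum_divide_distrib[symmetric])
        also have "1 - (p 0)\<^sup>2 = (1 - p 0) * (1 + p 0)"
          by (simp add: power2_eq_square algebra_simps)
        also have "(1 - p 0) * (1 + p 0) / (1 - p 0)\<^sup>2 = (1 + p 0) / (1 - p 0)"
          using p01 by (simp add: power2_eq_square)
        finally have T: "T = (1 + p 0) / (1 - p 0)" .
        have T1: "T + 1 = 2 / (1 - p 0)" using p01 by (simp add: T field_simps)
        have Qx: "Q ?x = t\<^sup>2 * T"
          unfolding Q_def T_def sum_distrib_left by (rule sum.cong) (auto simp: zx power_mult_distrib)
        have Dx: "D ?x = t\<^sup>2 * (T + 1)" by (simp add: D_def Qx mx algebra_simps)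
        have "\<phi> ?x i = p i" for i
        proof -
          consider "i = 0" | "0 < i" "i \<le> d" | "i > d" by linarith
          then show ?thesis
          proof cases
            case 1
            have "\<phi> ?x i = (t\<^sup>2 * (T - 1)) / (t\<^sup>2 * (T + 1))"
              using 1 by (simp add: \<phi>_def Qx Dx mx algebra_simps)
            also have "\<dots> = (T - 1) / (T + 1)" using t(1) by simp
            also have "\<dots> = p 0" unfolding T1 using p01 by (simp add: T field_simps)
            finally show ?thesis using 1 by simp
          next
            case 2
            have "\<phi> ?x i = (t\<^sup>2 * (2 * w i)) / (t\<^sup>2 * (T + 1))"
              using 2 by (simp add: \<phi>_def Dx mx zx power2_eq_square)
            also have "\<dots> = 2 * w i / (T + 1)" using t(1) by simp
            also have "\<dots> = p i" unfolding T1 using p01 2 by (simp add: w_def)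
            finally show ?thesis .
          next
            case 3
            then show ?thesis using p0 by (simp add: \<phi>_def)
          qed
        qed
        then have "p = \<phi> ?x" by (intro ext) simp
        then show ?thesis using x by (rule image_eqI)
      qed
    qed
  qed
  have closed: "closed_map ?X (nsphere d) \<phi>"
    using compact_space_closed_simplex[OF V(1)] cont
    by (intro continuous_imp_closed_map_gen Hausdorff_imp_kc_space)
       (auto simp: nsphere_def Hausdorff_space_subtopology Hausdorff_Euclidean_space)
  have "quotient_map ?X (nsphere d) \<phi>"
    by (rule continuous_closed_imp_quotient_map[OF cont closed]) (simp only: topX surj)
  then show thesis using base inj by (rule that)
qed

section \<open>A contractible complex with additional facets\<close>

text \<open>Each facet outside \<open>A\<close> meets the rest of the complex only in its boundary, which lies in \<open>A\<close>.
  Collapsing \<open>|A|\<close> therefore leaves a wedge of simplices modulo their boundaries.  At least two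
  vertices per facet are required because a single vertex has empty boundary, and its quotient map
  would miss the base point of the 0-sphere.\<close>

lemma realization_homotopy_equivalent_wedge:
  assumes V: "finite V" "\<Union>K \<subseteq> V" and K: "finite K" "A \<subseteq> K"
    and downK: "\<And>s r. s \<in> K \<Longrightarrow> r \<subseteq> s \<Longrightarrow> r \<in> K"
    and downA: "\<And>s r. s \<in> A \<Longrightarrow> r \<subseteq> s \<Longrightarrow> r \<in> A"
    and facets: "\<And>s t. s \<in> K - A \<Longrightarrow> t \<in> K \<Longrightarrow> s \<subseteq> t \<Longrightarrow> t = s"
    and contr: "contractible_space (realization V A)" "realization_points V A \<noteq> {}"
    and S: "K - A \<noteq> {}" "\<And>s. s \<in> K - A \<Longrightarrow> 2 \<le> card s"
  obtains k and d :: "nat \<Rightarrow> nat" where "0 < k" "\<And>i. i < k \<Longrightarrow> \<exists>s\<in>K - A. card s = Suc (d i)"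
    "realization V K homotopy_equivalent_space
       wedge_topology (\<lambda>i. nsphere (d i)) (\<lambda>_. nsphere_base) {..<k}"
proof -
  let ?S = "K - A" and ?PK = "realization_points V K" and ?PA = "realization_points V A"
  let ?X = "realization V K"
  have AK: "?PA \<subseteq> ?PK" by (rule realization_points_mono[OF K(2)])
  define k where "k = card ?S"
  have finS: "finite ?S" using K(1) by simp
  have k0: "0 < k" using finS S(1) by (simp add: k_def card_gt_0_iff)
  obtain \<sigma> where \<sigma>: "bij_betw \<sigma> {..<k} ?S"
    using ex_bij_betw_nat_finite[OF finS] unfolding k_def atLeast0LessThan by blast
  have \<sigma>S: "\<sigma> i \<in> ?S" if "i < k" for i using bij_betwE[OF \<sigma>] that by simp
  define d where "d i = card (\<sigma> i) - 1" for i
  have card: "card (\<sigma> i) = Suc (d i)" "0 < d i" if "i < k" for i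
    using S(2)[OF \<sigma>S[OF that]] by (auto simp: d_def)
  have \<sigma>V: "\<sigma> i \<subseteq> V" if "i < k" for i using \<sigma>S[OF that] V(2) by blast
  define C where "C i = closed_simplex V (\<sigma> i)" for i
  have "\<forall>i\<in>{..<k}. \<exists>\<phi>. quotient_map (subtopology (powertop_real V) (C i)) (nsphere (d i)) \<phi> \<and>
      (\<forall>x\<in>C i. \<phi> x = nsphere_base \<longleftrightarrow> (\<exists>v\<in>\<sigma> i. x v = 0)) \<and>
      (\<forall>x\<in>C i. \<forall>y\<in>C i. (\<forall>v\<in>\<sigma> i. x v \<noteq> 0) \<longrightarrow> (\<forall>v\<in>\<sigma> i. y v \<noteq> 0) \<longrightarrow> \<phi> x = \<phi> y \<longrightarrow> x = y)"
    (is "\<forall>i\<in>_. \<exists>\<phi>. ?pr i \<phi>")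
  proof
    fix i assume "i \<in> {..<k}"
    then have i: "i < k" by simp
    show "\<exists>\<phi>. ?pr i \<phi>"
    proof (rule simplex_boundary_quotient_sphere[OF V(1) \<sigma>V[OF i] card[OF i]], fold C_def)
      fix \<phi>
      assume "quotient_map (subtopology (powertop_real V) (C i)) (nsphere (d i)) \<phi>"
        "\<And>x. x \<in> C i \<Longrightarrow> \<phi> x = nsphere_base \<longleftrightarrow> (\<exists>v\<in>\<sigma> i. x v = 0)"
        "\<And>x y. x \<in> C i \<Longrightarrow> y \<in> C i \<Longrightarrow> \<forall>v\<in>\<sigma> i. x v \<noteq> 0 \<Longrightarrow> \<forall>v\<in>\<sigma> i. y v \<noteq> 0 \<Longrightarrow>
          \<phi> x = \<phi> y \<Longrightarrow> x = y"
      then show "\<exists>\<phi>. ?pr i \<phi>" by (intro exI[of _ \<phi>] conjI ballI impI)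
    qed
  qed
  from bchoice[OF this] obtain \<phi> where \<phi>_all: "\<forall>i\<in>{..<k}. ?pr i (\<phi> i)" ..
  then have
      \<phi>: "\<And>i. i < k \<Longrightarrow> quotient_map (subtopology (powertop_real V) (C i)) (nsphere (d i)) (\<phi> i)"
      and base: "\<And>i x. i < k \<Longrightarrow> x \<in> C i \<Longrightarrow> \<phi> i x = nsphere_base \<longleftrightarrow> (\<exists>v\<in>\<sigma> i. x v = 0)"
      and inj: "\<And>i x y. i < k \<Longrightarrow> x \<in> C i \<Longrightarrow> y \<in> C i \<Longrightarrow> \<forall>v\<in>\<sigma> i. x v \<noteq> 0 \<Longrightarrow>
          \<forall>v\<in>\<sigma> i. y v \<noteq> 0 \<Longrightarrow> \<phi> i x = \<phi> i y \<Longrightarrow> x = y"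
    by (simp_all only: lessThan_iff Ball_def)
  have C_supp: "support V x \<subseteq> \<sigma> i" if "x \<in> C i" for x i
    using that by (auto simp: C_def closed_simplex_def support_def)
  have CK: "C i \<subseteq> ?PK" if "i < k" for i
  proof
    fix x assume x: "x \<in> C i"
    have "support V x \<in> K" using downK[OF _ C_supp[OF x]] \<sigma>S[OF that] by blast
    then show "x \<in> ?PK" using x by (simp add: C_def closed_simplex_def realization_points_def)
  qed
  have C_A: "x \<in> ?PA \<longleftrightarrow> (\<exists>v\<in>\<sigma> i. x v = 0)" "x \<notin> ?PA \<Longrightarrow> support V x = \<sigma> i"
    if i: "i < k" and x: "x \<in> C i" for x i
  proof -
    have xK: "x \<in> ?PK" using CK[OF i] x by (rule subsetD)
    have "x \<in> ?PA \<longleftrightarrow> support V x \<noteq> \<sigma> i"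
    proof
      assume "x \<in> ?PA"
      then show "support V x \<noteq> \<sigma> i" using \<sigma>S[OF i] realization_pointsD(4)[of x V A] by auto
    next
      assume "support V x \<noteq> \<sigma> i"
      moreover have "\<sigma> i \<in> K" using \<sigma>S[OF i] by blast
      ultimately have "support V x \<notin> ?S" using facets C_supp[OF x] by metis
      then show "x \<in> ?PA" using xK by (simp add: realization_points_def)
    qed
    moreover have "support V x = \<sigma> i \<longleftrightarrow> \<not> (\<exists>v\<in>\<sigma> i. x v = 0)"
      using C_supp[OF x] \<sigma>V[OF i] by (auto simp: support_def)
    ultimately show "x \<in> ?PA \<longleftrightarrow> (\<exists>v\<in>\<sigma> i. x v = 0)" "x \<notin> ?PA \<Longrightarrow> support V x = \<sigma> i" by blast+
  qed
  define idx where "idx x = inv_into {..<k} \<sigma> (support V x)" for x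
  have idx: "idx x = i" if "i < k" "support V x = \<sigma> i" for x i
    using that bij_betw_inv_into_left[OF \<sigma>] by (simp add: idx_def)
  have open_cell: "idx x < k \<and> x \<in> C (idx x)" if x: "x \<in> ?PK" "x \<notin> ?PA" for x
  proof -
    have "support V x \<in> ?S" using x by (auto simp: realization_points_def)
    then obtain i where i: "i < k" "support V x = \<sigma> i"
      using bij_betw_imp_surj_on[OF \<sigma>] by (metis imageE lessThan_iff)
    moreover have "x \<in> C i"
      using realization_pointsD[OF x(1)] i(2)[symmetric] by (simp add: C_def closed_simplex_def support_def)
    ultimately show ?thesis using idx by metis
  qed
  define q where "q x = (if x \<in> ?PA then None else Some (idx x, \<phi> (idx x) x))" for x
  let ?W = "wedge_topology (\<lambda>i. nsphere (d i)) (\<lambda>_. nsphere_base) {..<k}"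
  have quot: "quotient_map ?X ?W q"
  proof (rule quotient_map_to_wedge)
    show "finite {..<k}" "{..<k} \<noteq> {}" using k0 by auto
    show "nsphere_base \<in> topspace (nsphere (d i))" for i by (rule nsphere_base_in_nsphere)
    show "closedin ?X ?PA"
      using closedin_realization_points[OF V(1) finite_subset[OF K(2,1)] K(2) downA] .
    show "?PA \<noteq> {}" by (rule contr)
    show "closedin ?X (C i)" if "i \<in> {..<k}" for i
      unfolding realization_def C_def using CK that
      by (intro closedin_subset_topspace closedin_closed_simplex V) (auto simp: C_def)
    show "topspace ?X = ?PA \<union> (\<Union>i\<in>{..<k}. C i)"
      unfolding topspace_realization using AK CK open_cell by blast
    show "quotient_map (subtopology ?X (C i)) (nsphere (d i)) (\<phi> i)" if "i \<in> {..<k}" for i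
      using \<phi>[of i] CK[of i] that by (simp add: realization_def subtopology_subtopology Int_absorb1)
    show "q x = None" if "x \<in> ?PA" for x using that by (simp add: q_def)
    show "q x = wedge_map (\<lambda>_. nsphere_base) (i, \<phi> i x)" if i: "i \<in> {..<k}" and x: "x \<in> C i" for i x
    proof (cases "x \<in> ?PA")
      case True
      then show ?thesis using C_A(1)[of i x] base[of i x] i x by (simp add: q_def wedge_map_def)
    next
      case False
      then have "idx x = i" using C_A(2)[of i x] idx[of i x] i x by simp
      then show ?thesis using False C_A(1)[of i x] base[of i x] i x by (simp add: q_def wedge_map_def)
    qed
  qed
  have fibres: "q x = q y \<longleftrightarrow> x = y \<or> x \<in> ?PA \<and> y \<in> ?PA" if x: "x \<in> ?PK" and y: "y \<in> ?PK" for x y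
  proof (cases "x \<in> ?PA \<or> y \<in> ?PA")
    case True
    then show ?thesis by (auto simp: q_def)
  next
    case False
    then have nA: "x \<notin> ?PA" "y \<notin> ?PA" by auto
    have "x = y" if "q x = q y"
    proof -
      have "idx x = idx y" "\<phi> (idx x) x = \<phi> (idx x) y" using that nA by (auto simp: q_def)
      then show ?thesis
        using inj[of "idx x" x y] open_cell[OF x nA(1)] open_cell[OF y nA(2)]
          C_A(1)[of "idx x" x] C_A(1)[of "idx x" y] nA by auto
    qed
    then show ?thesis using nA by auto
  qed
  have "?X homotopy_equivalent_space ?W"
  proof (rule deformation_crushing_subcomplex[OF V K _ _ _ contr(1)])
    show "r \<in> K" if "s \<in> K" "r \<subseteq> s" for s r by (rule downK[OF that])
    show "t = s" if "s \<in> ?S" "t \<in> K" "s \<subseteq> t" for s t by (rule facets[OF that])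
    show "{} \<notin> ?S" using S(2)[of "{}"] by auto
    fix f a
    assume hom: "homotopic_with (\<lambda>k. k ` ?PA \<subseteq> ?PA) ?X ?X id f"
      and const: "\<And>x. x \<in> ?PA \<Longrightarrow> f x = a"
    show "?X homotopy_equivalent_space ?W"
    proof (rule quotient_of_deformable_subset_homotopy_equivalent[OF quot _ _ hom const])
      show "?PA \<subseteq> topspace ?X" using AK by simp
      show "q x = q y \<longleftrightarrow> x = y \<or> x \<in> ?PA \<and> y \<in> ?PA"
        if "x \<in> topspace ?X" "y \<in> topspace ?X" for x y
        using fibres that by simp
    qed
  qed
  then show thesis using that[of k d] k0 \<sigma>S card(1) by blast
qed

theorem theorem3p14:
  fixes F :: "'v graph"
  assumes "forest F"
  shows "let X = geometric_realization (devoid_complex F (path_graph 3)) in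
         (topspace X \<noteq> {} \<and> contractible_space X) \<or>
         homotopy_wedge_of_spheres X (2 * int (ind3 F) - 1)"
proof -
  have G: "fin_graph F" using assms by (simp add: forest_def)
  then have finU: "finite (verts F)" by (simp add: fin_graph_def)
  define K where "K = P3_free_faces F (verts F)"
  define V where "V = \<Union>K"
  have X: "geometric_realization (devoid_complex F (path_graph 3)) = realization V K"
    unfolding devoid_complex_P3[OF G] K_def V_def by (rule geometric_realization_eq)
  obtain A where A: "A \<subseteq> K" "collapsible A"
    and facets: "\<And>s t. s \<in> K - A \<Longrightarrow> t \<in> K \<Longrightarrow> s \<subseteq> t \<Longrightarrow> t = s"
    and matching: "\<And>s. s \<in> K - A \<Longrightarrow> \<exists>M. induced_matching (path_graph 3) F M \<and> card s = 2 * card M"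
    using collapsible_plus_critical_facets[OF G finU forest_sparse[OF assms]]
    unfolding K_def by metis
  have card_le: "\<exists>n \<le> ind3 F. card s = 2 * n" if "s \<in> K - A" for s
  proof -
    obtain M where M: "induced_matching (path_graph 3) F M" "card s = 2 * card M"
      using matching[OF \<open>s \<in> K - A\<close>] by blast
    have "card M \<le> ind3 F"
      unfolding ind_number_def
      using ind_number_Max_well_defined(1)[OF G, of "path_graph 3"] M(1) by (intro Max_ge) auto
    then show ?thesis using M(2) by blast
  qed
  have finK: "finite K" unfolding K_def by (rule P3_free_faces_finite(1)[OF finU])
  have fin_face: "finite s" if "s \<in> K" for s
    using that unfolding K_def by (rule P3_free_faces_finite(2)[OF finU])
  have downK: "r \<in> K" if "s \<in> K" "r \<subseteq> s" for s r
    using P3_free_faces_down that unfolding K_def by blast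
  have finV: "finite V"
    unfolding V_def using finK fin_face by (rule finite_Union)
  have empty_K: "{} \<in> K" unfolding K_def by (rule P3_free_facesI) auto
  show ?thesis
  proof (cases "A = {}")
    case True
    \<comment> \<open>The empty face is critical, hence a facet, so it is the only face.\<close>
    have "K = {{}}" using facets[of "{}"] empty_K True by auto
    then have "V = {}" by (simp add: V_def)
    then have "topspace (realization V K) = {}"
      by (simp add: realization_points_def)
    then have triv: "realization V K = trivial_topology"
      by (simp only: null_topspace_iff_trivial)
    have "realization V K homotopy_equivalent_space (trivial_topology :: (nat \<Rightarrow> real) topology)"
      unfolding triv homotopy_equivalent_space_def
      by (intro exI[of _ "\<lambda>_. undefined"] conjI homotopic_with_equal) simp_all
    then show ?thesis unfolding X homotopy_wedge_of_spheres_def Let_def by simp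
  next
    case False
    have contr: "contractible_space (realization V A)" "realization_points V A \<noteq> {}"
      using contractible_realization_collapsible[OF A(2) False finV] A(1) by (auto simp: V_def)
    show ?thesis
    proof (cases "K - A = {}")
      case True
      then have "K = A" using A(1) by blast
      then show ?thesis using contr unfolding X Let_def by simp
    next
      case critical: False
      have "{} \<in> A" using False collapsible_downward_closed[OF A(2)] by blast
      have card2: "2 \<le> card s" if s: "s \<in> K - A" for s
      proof -
        have "s \<noteq> {}" using s \<open>{} \<in> A\<close> by auto
        moreover have "finite s" using s fin_face by blast
        ultimately have "card s \<noteq> 0" by simp
        then show ?thesis using card_le[OF s] by auto
      qed
      show ?thesis
      proof (rule realization_homotopy_equivalent_wedge[OF finV _ finK A(1) downK _ facets contr critical card2])
        show "\<Union>K \<subseteq> V" by (simp add: V_def)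
        show "r \<in> A" if "s \<in> A" "r \<subseteq> s" for s r
          by (rule collapsible_downward_closed[OF A(2) that])
        fix k and d :: "nat \<Rightarrow> nat"
        assume k: "0 < k" and d: "\<And>i. i < k \<Longrightarrow> \<exists>s\<in>K - A. card s = Suc (d i)"
          and wedge: "realization V K homotopy_equivalent_space
            wedge_topology (\<lambda>i. nsphere (d i)) (\<lambda>_. nsphere_base) {..<k}"
        have "int (d i) \<le> 2 * int (ind3 F) - 1" if i: "i < k" for i
        proof -
          obtain s where s: "s \<in> K - A" "card s = Suc (d i)" using d[OF i] by blast
          then show ?thesis using card_le[OF s(1)] by auto
        qed
        then show "let X = geometric_realization (devoid_complex F (path_graph 3)) in
            (topspace X \<noteq> {} \<and> contractible_space X) \<or>
            homotopy_wedge_of_spheres X (2 * int (ind3 F) - 1)"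
          using k wedge unfolding X Let_def homotopy_wedge_of_spheres_def by blast
      qed
    qed
  qed
qed

end
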